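(* For every tree $T$, \[\rho(T)=\max_{v\in V(T)}\left\lfloor \frac{\ell_3(v)}{2}\right\rfloor.\]
   Context: Patrol game with radius of capture $\rho\ge 0$ on a connected graph $G$: there is one cop and one robber. Before the game the cop fixes a walk in $G$ (his patrol: a sequence of vertices in which consecutive vertices are equal or adjacent), and the robber knows the entire patrol in advance, while the cop has no information about the robber. The cop starts at the first vertex of his patrol, then the robber chooses a starting vertex; afterwards the players alternate moves (cop first), the cop following his patrol and the robber moving to an adjacent vertex or staying put. The cop wins if at some moment the distance between the cop and the robber is at most $\rho$; otherwise the robber wins. $\rho(G)$ is the minimum $\rho\ge0$ for which the cop has a patrol capturing the robber regardless of the robber's play. A triod is a tree with exactly three leaves and a unique vertex of degree three, its origin; for a triod $T'$, $\ell_3(T')$ is the distance from the origin to the closest of the three leaves. For a graph $G$ and a vertex $v$ of degree at least $3$, $\ell_3(v)$ is the maximum of $\ell_3(T')$ over all induced subgraphs $T'$ of $G$ that are triods with origin $v$; if $v$ has degree less than $3$, $\ell_3(v)=0$. *)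

theory Defs
  imports "Graph_Theory.Graph_Theory"
begin

text \<open>
  Finite simple graphs are rendered by the locale \<open>pair_graph\<close>: an undirected edge \<open>uv\<close> is the
  pair of arcs \<open>(u, v)\<close> and \<open>(v, u)\<close>, so the degree of a vertex is its \<open>out_degree\<close>. The back and
  forth walk along one edge is a \<open>cycle\<close> of length 2 in the sense of the library, and the
  library's \<open>tree\<close> therefore excludes every symmetric graph with an edge. Undirected cycles are
  the library cycles of length at least 3.
\<close>

definition undirected_tree :: "'a pair_pre_digraph \<Rightarrow> bool" where
  "undirected_tree G \<longleftrightarrow>
     pair_graph G \<and> connected (with_proj G) \<and>
     \<not> (\<exists>c. pre_digraph.cycle (with_proj G) c \<and> 3 \<le> length c)"

definition leaves :: "'a pair_pre_digraph \<Rightarrow> 'a set" where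
  "leaves G = {v \<in> pverts G. out_degree (with_proj G) v = 1}"

text \<open>Meaningful only if \<open>v\<close> is reachable from \<open>u\<close>.\<close>
definition graph_dist :: "'a pair_pre_digraph \<Rightarrow> 'a \<Rightarrow> 'a \<Rightarrow> nat" where
  "graph_dist G u v = (LEAST n. \<exists>p. pre_digraph.awalk (with_proj G) u p v \<and> length p = n)"

lemma (in pair_wf_digraph) graph_dist_eq_\<mu>:
  assumes "u \<rightarrow>\<^sup>*\<^bsub>with_proj G\<^esub> v"
  shows "ereal (real (graph_dist G u v)) = \<mu> (\<lambda>_. 1) u v"
proof -
  let ?P = "\<lambda>n. \<exists>p. awalk u p v \<and> length p = n"
  have cost: "awalk_cost (\<lambda>_. 1) p = real (length p)" for p :: "('a \<times> 'a) list"
    by (induction p) auto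
  have "\<exists>n. ?P n" using assms by (auto simp: reachable_awalk)
  then have P: "?P (graph_dist G u v)"
    unfolding graph_dist_def by (rule LeastI_ex)
  show ?thesis
  proof (rule antisym)
    show "ereal (real (graph_dist G u v)) \<le> \<mu> (\<lambda>_. 1) u v"
      unfolding \<mu>_def by (rule INF_greatest) (auto simp: cost graph_dist_def intro!: Least_le)
    show "\<mu> (\<lambda>_. 1) u v \<le> ereal (real (graph_dist G u v))"
      using P min_cost_le_walk_cost[of u _ v "\<lambda>_. 1"] by (metis cost)
  qed
qed


section \<open>The patrol game\<close>

text \<open>
  Plays are infinite; a finite patrol is subsumed by letting the cop stay at its last vertex.
\<close>

definition lazy_walk :: "'a pair_pre_digraph \<Rightarrow> (nat \<Rightarrow> 'a) \<Rightarrow> bool" where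
  "lazy_walk G w \<longleftrightarrow>
     (\<forall>i. w i \<in> pverts G) \<and> (\<forall>i. w (Suc i) = w i \<or> (w i, w (Suc i)) \<in> parcs G)"

text \<open>
  The \<open>i\<close>-th cop move takes the cop from \<open>c i\<close> to \<open>c (Suc i)\<close> while the robber is at \<open>r i\<close>; the
  robber then moves to \<open>r (Suc i)\<close>. The two disjuncts are the positions before and after the
  \<open>i\<close>-th cop move, hence together all positions of the game.
\<close>

definition captured :: "'a pair_pre_digraph \<Rightarrow> nat \<Rightarrow> (nat \<Rightarrow> 'a) \<Rightarrow> (nat \<Rightarrow> 'a) \<Rightarrow> bool" where
  "captured G k c r \<longleftrightarrow>
     (\<exists>i. graph_dist G (c i) (r i) \<le> k \<or> graph_dist G (c (Suc i)) (r i) \<le> k)"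

text \<open>
  As the whole patrol \<open>c\<close> is fixed and known to the robber, his possible plays (including the
  choice of a starting vertex) are exactly the lazy walks.
\<close>

definition winning_patrol :: "'a pair_pre_digraph \<Rightarrow> nat \<Rightarrow> (nat \<Rightarrow> 'a) \<Rightarrow> bool" where
  "winning_patrol G k c \<longleftrightarrow> lazy_walk G c \<and> (\<forall>r. lazy_walk G r \<longrightarrow> captured G k c r)"

definition patrol_radius :: "'a pair_pre_digraph \<Rightarrow> nat" where
  "patrol_radius G = (LEAST k. \<exists>c. winning_patrol G k c)"

lemma ex_winning_patrol:
  assumes "pair_graph G" "connected (with_proj G)"
  shows "\<exists>k c. winning_patrol G k c"
proof -
  interpret pair_graph G by fact
  obtain v where v: "v \<in> pverts G"
    using assms(2) by (auto simp: connected_def strongly_connected_def mk_symmetric_def)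
  have "winning_patrol G (Max (graph_dist G v ` pverts G)) (\<lambda>_. v)"
    using v pair_finite_verts by (auto simp: winning_patrol_def lazy_walk_def captured_def)
  then show ?thesis by blast
qed


section \<open>Triods\<close>

text \<open>\<open>triod T v\<close>: \<open>T\<close> is a triod with origin \<open>v\<close>.\<close>

definition triod :: "'a pair_pre_digraph \<Rightarrow> 'a \<Rightarrow> bool" where
  "triod T v \<longleftrightarrow>
     undirected_tree T \<and> card (leaves T) = 3 \<and>
     v \<in> pverts T \<and> out_degree (with_proj T) v = 3 \<and>
     (\<forall>u \<in> pverts T. out_degree (with_proj T) u = 3 \<longrightarrow> u = v)"

definition triod_ell3 :: "'a pair_pre_digraph \<Rightarrow> 'a \<Rightarrow> nat" where
  "triod_ell3 T v = Min (graph_dist T v ` leaves T)"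

text \<open>
  In a tree, a vertex of degree at least 3 together with three of its neighbours induces a triod,
  so the set below is then finite and nonempty.
\<close>

definition ell3 :: "'a pair_pre_digraph \<Rightarrow> 'a \<Rightarrow> nat" where
  "ell3 G v =
     (if 3 \<le> out_degree (with_proj G) v
      then Max {triod_ell3 T v | T. induced_subgraph (with_proj T) (with_proj G) \<and> triod T v}
      else 0)"

end

(*
  Lower bound. Let a0, a1, a2 be vertices at distance L = 2 k + 2 from v in three different branches
  at v. The coordinate X i t = L - d (c t) (a i) of the cop along leg i changes by at most one per
  step, and X i + X j <= 0 for i distinct from j, so the cop is deep (X i >= k + 2) in at most one
  leg at a time. At time t the robber lives on a leg i in which the cop is deep neither at the last
  deep moment nor at the next one, at depth max 0 (k + 1 + max (X i t) (X i (t + 1))). This depth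
  never exceeds L, keeps him at distance more than k, and vanishes around the deep moments, when he
  may change legs through v.

  Upper bound. Let every vertex have at most two branches of height at least 2 k + 2. Then all
  branches hanging off a diametral path have height at most 2 k + 1. The cop traverses this path and
  searches the side branches depth first, down to depth k + 1: while he is within distance k of the
  foot of the branch, the robber cannot return to the cleared part, since that requires passing
  through a vertex between the foot and the cop. At depth k + 1 the foot is unguarded for a single
  move only, which is too short to use it, and the ball of radius k covers the rest of the branch.
*)
theory Submission
  imports Defs
begin

section \<open>Distances and branches in trees\<close>

lemma pawalk_verts_snoc:
  "pcas w p u \<Longrightarrow> pawalk_verts w (p @ [(u, v)]) = pawalk_verts w p @ [v]"
  by (induction p arbitrary: w) auto

text \<open>A locale, so that triods inside the tree can later be interpreted as trees in their own
  right and inherit the theory of branches and leaves.\<close>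

locale undir_tree = pair_graph T for T :: "'a pair_pre_digraph" +
  assumes connected_T: "connected (with_proj T)"
    and no_long_cycle: "\<not> (cycle c \<and> 3 \<le> length c)"

lemma undirected_tree_iff: "undirected_tree T \<longleftrightarrow> undir_tree T"
  by (auto simp: undirected_tree_def undir_tree_def undir_tree_axioms_def)

context undir_tree
begin

abbreviation V :: "'a set" where "V \<equiv> pverts T"
abbreviation E :: "('a \<times> 'a) set" where "E \<equiv> parcs T"
abbreviation d :: "'a \<Rightarrow> 'a \<Rightarrow> nat" where "d \<equiv> graph_dist T"

lemma V_nonempty: "V \<noteq> {}"
  using connected_T by (auto simp: connected_def strongly_connected_def mk_symmetric_def)

section \<open>The graph distance as a metric\<close>

lemma ex_awalk:
  assumes "u \<in> V" "v \<in> V"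
  shows "\<exists>p. awalk u p v"
proof -
  have "strongly_connected (with_proj T)"
    by (rule symmetric_connected_imp_strongly_connected[OF _ connected_T]) (rule pair_sym_arcs)
  then show ?thesis
    using assms by (auto simp: strongly_connected_def reachable_awalk)
qed

lemma dist_le_length: "awalk u p v \<Longrightarrow> d u v \<le> length p"
  unfolding graph_dist_def by (rule Least_le) blast

lemma dist_awalk:
  assumes "u \<in> V" "v \<in> V"
  obtains p where "awalk u p v" "length p = d u v"
proof -
  have "\<exists>n p. awalk u p v \<and> length p = n"
    using ex_awalk[OF assms] by blast
  from LeastI_ex[OF this] show thesis
    using that unfolding graph_dist_def by blast
qed

lemma dist_self [simp]: "u \<in> V \<Longrightarrow> d u u = 0"
  using dist_le_length[of u "[]" u] by (simp add: awalk_Nil_iff)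

lemma dist_commute:
  assumes "u \<in> V" "v \<in> V"
  shows "d u v = d v u"
proof -
  have "d u v \<le> d v u" if uv: "u \<in> V" "v \<in> V" for u v
  proof -
    obtain p where "awalk v p u" "length p = d v u"
      using dist_awalk[OF uv(2,1)] by blast
    moreover have "length (rev_path p) = length p" for p :: "('a \<times> 'a) list"
      by (induction p) auto
    ultimately show ?thesis
      using dist_le_length[of u "rev_path p" v] by simp
  qed
  then show ?thesis using assms by (simp add: le_antisym)
qed

lemma dist_triangle:
  assumes "u \<in> V" "v \<in> V" "w \<in> V"
  shows "d u w \<le> d u v + d v w"
proof -
  obtain p where p: "awalk u p v" "length p = d u v" using dist_awalk assms by blast
  obtain q where q: "awalk v q w" "length q = d v w" using dist_awalk assms by blast
  show ?thesis using dist_le_length[of u "p @ q" w] p q by auto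
qed

lemma dist_eq_0_iff:
  assumes "u \<in> V" "v \<in> V"
  shows "d u v = 0 \<longleftrightarrow> u = v"
proof
  assume "d u v = 0"
  moreover obtain p where "awalk u p v" "length p = d u v" by (rule dist_awalk[OF assms])
  ultimately show "u = v" by (auto simp: awalk_Nil_iff)
qed (use assms in simp)

lemma dist_edge:
  assumes "(u, v) \<in> E"
  shows "d u v = 1"
proof -
  have "d u v \<le> 1"
    using dist_le_length[of u "[(u, v)]" v] assms by (simp add: awalk_simps wellformed')
  moreover have "d u v \<noteq> 0"
    using assms dist_eq_0_iff no_loops' wellformed' by blast
  ultimately show ?thesis by simp
qed

lemma dist_step:
  assumes "u \<in> V" "v \<in> V" "u \<noteq> v"
  obtains z where "(u, z) \<in> E" "d u v = Suc (d z v)"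
proof -
  obtain p where p: "awalk u p v" "length p = d u v" using dist_awalk assms by blast
  with assms obtain e es where es: "p = e # es"
    by (cases p) (auto simp: awalk_simps)
  then have e: "(u, snd e) \<in> E" "awalk (snd e) es v"
    using p by (auto simp: awalk_simps)
  have "d (snd e) v \<le> length es" using e dist_le_length by blast
  moreover have "d u v \<le> Suc (d (snd e) v)"
    using dist_triangle[of u "snd e" v] dist_edge[OF e(1)] in_arcsD2[OF e(1)] assms by simp
  ultimately show thesis using that[of "snd e"] e p es by simp
qed

text \<open>\<open>S\<close> is what \<open>v\<close> still reaches once both arcs of the edge are
  deleted. Were \<open>u\<close> among it, a path from \<open>v\<close> to \<open>u\<close> closed
  up by \<open>(u, v)\<close> would be a long cycle.\<close>

lemma edge_cut:
  assumes uv: "(u, v) \<in> E"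
  obtains S where "u \<notin> S" "v \<in> S" "\<And>x y. (x, y) \<in> E \<Longrightarrow> x \<in> S \<Longrightarrow> y \<notin> S \<Longrightarrow> x = v \<and> y = u"
proof -
  define H where "H = \<lparr>pverts = V, parcs = E - {(u, v), (v, u)}\<rparr>"
  interpret H: pair_wf_digraph H
    by unfold_locales (auto simp: H_def arc_fst_in_verts arc_snd_in_verts)
  have sub: "subgraph (with_proj H) (with_proj T)"
    by (rule subgraphI) (simp_all add: H_def compatibleI_with_proj H.wf_digraph[unfolded H_def] wf_digraph)
  have parcs_H: "parcs H = E - {(u, v), (v, u)}" by (simp add: H_def)
  define S where "S = {x. v \<rightarrow>\<^sup>*\<^bsub>with_proj H\<^esub> x}"
  have vV: "v \<in> pverts H" using uv wellformed' by (auto simp: H_def)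
  have v_S: "v \<in> S" using vV by (simp add: S_def)
  have u_S: "u \<notin> S"
  proof
    assume "u \<in> S"
    then obtain p where p: "H.apath v p u" unfolding S_def using H.reachable_apath by blast
    then have arcs: "set p \<subseteq> parcs H" by (auto simp: H.apath_def)
    have ap: "apath v p u" using subgraph_apath_imp_apath[OF p sub] .
    have "p \<noteq> []" using ap no_loops'[OF uv] by (auto simp: apath_Nil_iff)
    \<comment> \<open>The one-arc path would be the deleted arc \<open>(v, u)\<close>. Excluding it
      lifts the closed walk from the harmless length 2 to at least 3.\<close>
    moreover have "p \<noteq> [e]" for e
    proof
      assume "p = [e]"
      with ap have "e = (v, u)" by (cases e) (auto simp: apath_simps)
      then show False using arcs \<open>p = [e]\<close> parcs_H by simp
    qed
    then have "length p \<noteq> 1" by (auto simp: length_Suc_conv)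
    moreover have "length p \<noteq> 0" using \<open>p \<noteq> []\<close> by simp
    ultimately have len: "length p \<ge> 2" by linarith
    have aw: "awalk v p u" using ap by (simp add: apath_def)
    then have "awalk v (p @ [(u, v)]) v"
      using arc_implies_awalk[OF uv] by (intro awalk_appendI) simp_all
    moreover have "distinct (tl (awalk_verts v (p @ [(u, v)])))"
    proof -
      have "awalk_verts v (p @ [(u, v)]) = awalk_verts v p @ [v]"
        using aw by (intro pawalk_verts_snoc) (simp add: awalk_def)
      moreover have "distinct (awalk_verts v p)" using ap by (simp add: apath_def)
      moreover obtain ws where "awalk_verts v p = v # ws"
        using aw by (cases p) (simp_all add: awalk_simps)
      ultimately show ?thesis by simp
    qed
    ultimately have "cycle (p @ [(u, v)])" unfolding cycle_def by blast
    then show False using no_long_cycle[of "p @ [(u, v)]"] len by simp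
  qed
  have "x = v \<and> y = u" if xy: "(x, y) \<in> E" "x \<in> S" "y \<notin> S" for x y
  proof -
    have "(x, y) \<notin> parcs H"
    proof
      assume "(x, y) \<in> parcs H"
      moreover have "v \<rightarrow>\<^sup>*\<^bsub>with_proj H\<^esub> x" using xy(2) by (simp add: S_def)
      ultimately have "v \<rightarrow>\<^sup>*\<^bsub>with_proj H\<^esub> y" by (rule H.reachable_adj_trans[rotated])
      then show False using xy(3) by (simp add: S_def)
    qed
    then have "(x, y) = (u, v) \<or> (x, y) = (v, u)" using xy(1) parcs_H by blast
    then show ?thesis using u_S xy(2) by blast
  qed
  then show thesis by (rule that[OF u_S v_S])
qed

text \<open>For an edge \<open>xz\<close> this is the component of \<open>z\<close> after deletion
  of the edge, by \<open>branch_cut\<close>. The metric form turns membership into arithmetic of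
  distances.\<close>

definition branch :: "'a \<Rightarrow> 'a \<Rightarrow> 'a set" where
  "branch x z = {y \<in> V. d x y = Suc (d z y)}"

lemma edge_sym: "(x, y) \<in> E \<Longrightarrow> (y, x) \<in> E"
  by (rule arcs_symmetric)

lemma branch_V: "y \<in> branch x z \<Longrightarrow> y \<in> V"
  and branch_dist: "y \<in> branch x z \<Longrightarrow> d x y = Suc (d z y)"
  by (simp_all add: branch_def)

text \<open>Every walk that leaves \<open>S\<close> must use the edge from \<open>v\<close> to
  \<open>u\<close>.\<close>

lemma cut_dist:
  assumes uv: "(u, v) \<in> E" and S: "u \<notin> S" "v \<in> S"
    and cut: "\<And>x y. (x, y) \<in> E \<Longrightarrow> x \<in> S \<Longrightarrow> y \<notin> S \<Longrightarrow> x = v \<and> y = u"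
    and x: "x \<in> S" "x \<in> V" and w: "w \<in> V" "w \<notin> S"
  shows "d x w = Suc (d v x + d u w)"
proof (rule antisym)
  have V: "u \<in> V" "v \<in> V" using uv wellformed' by auto
  have "d x w \<le> d x v + (d v u + d u w)"
    using dist_triangle[of x v w] dist_triangle[of v u w] V x w by linarith
  then show "d x w \<le> Suc (d v x + d u w)"
    using dist_edge[OF edge_sym[OF uv]] dist_commute[of x v] V x by simp
  \<comment> \<open>Induction along a shortest walk to \<open>w\<close>: its first step either stays
    in \<open>S\<close> or is the crossing from \<open>v\<close> to \<open>u\<close>.\<close>
  show "Suc (d v x + d u w) \<le> d x w"
    using x
  proof (induction "d x w" arbitrary: x)
    case 0
    then show ?case using dist_eq_0_iff[of x w] w by auto
  next
    case (Suc n)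
    then have "x \<noteq> w" using w by auto
    then obtain z where z: "(x, z) \<in> E" "d x w = Suc (d z w)"
      using dist_step Suc.prems w by metis
    have zV: "z \<in> V" using z wellformed' by auto
    show ?case
    proof (cases "z \<in> S")
      case True
      then have "Suc (d v z + d u w) \<le> d z w"
        using Suc zV z by simp
      moreover have "d v x \<le> d v z + d z x"
        using dist_triangle[of v z x] V zV Suc.prems by simp
      ultimately show ?thesis
        using z dist_edge[OF edge_sym[OF z(1)]] by simp
    next
      case False
      then have "x = v" "z = u" using cut[OF z(1)] Suc.prems by auto
      then show ?thesis using z V by simp
    qed
  qed
qed

lemma branch_cut:
  assumes uv: "(u, v) \<in> E"
  obtains S where "S \<inter> V = branch u v" "V - S = branch v u"
    "\<And>x y. (x, y) \<in> E \<Longrightarrow> x \<in> S \<Longrightarrow> y \<notin> S \<Longrightarrow> x = v \<and> y = u"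
    "\<And>x w. x \<in> S \<Longrightarrow> x \<in> V \<Longrightarrow> w \<in> V \<Longrightarrow> w \<notin> S \<Longrightarrow> d x w = Suc (d v x + d u w)"
proof -
  have V: "u \<in> V" "v \<in> V" using uv wellformed' by auto
  obtain S where S: "u \<notin> S" "v \<in> S"
    "\<And>x y. (x, y) \<in> E \<Longrightarrow> x \<in> S \<Longrightarrow> y \<notin> S \<Longrightarrow> x = v \<and> y = u"
    using edge_cut[OF uv] by metis
  have D: "d x w = Suc (d v x + d u w)" if "x \<in> S" "x \<in> V" "w \<in> V" "w \<notin> S" for x w
    by (rule cut_dist[OF uv S that])
  have in_S: "d u x = Suc (d v x)" if "x \<in> S" "x \<in> V" for x
    using D[of x u] that S V dist_commute[of x u] by simp
  have not_S: "d v x = Suc (d u x)" if "x \<notin> S" "x \<in> V" for x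
    using D[of v x] that S V by simp
  have "S \<inter> V = branch u v" "V - S = branch v u"
    using in_S not_S unfolding branch_def by force+
  then show thesis using that S(3) D by presburger
qed

lemma branch_cases:
  assumes "(u, v) \<in> E" "y \<in> V"
  shows "y \<in> branch u v \<or> y \<in> branch v u"
  by (rule branch_cut[OF assms(1)]) (use assms(2) in blast)

lemma branch_exit:
  assumes uv: "(u, v) \<in> E" and "(x, y) \<in> E" "x \<in> branch u v" "y \<notin> branch u v"
  shows "x = v \<and> y = u"
proof -
  have "x \<in> V" "y \<in> V" using assms(2) wellformed' by auto
  with assms(2-) show ?thesis by (rule_tac branch_cut[OF uv]) blast
qed

lemma dist_across:
  assumes uv: "(u, v) \<in> E" and "x \<in> branch u v" "w \<in> branch v u"
  shows "d x w = Suc (d v x + d u w)"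
proof -
  obtain S where S: "S \<inter> V = branch u v" "V - S = branch v u"
    "\<And>x w. x \<in> S \<Longrightarrow> x \<in> V \<Longrightarrow> w \<in> V \<Longrightarrow> w \<notin> S \<Longrightarrow> d x w = Suc (d v x + d u w)"
    using branch_cut[OF uv] by metis
  show ?thesis using S(3)[of x w] assms S(1,2) by auto
qed

lemma neighbour_in_branch: "(x, z) \<in> E \<Longrightarrow> z \<in> branch x z"
  using dist_edge[of x z] wellformed' by (auto simp: branch_def)

lemma not_in_own_branch: "x \<notin> branch x z"
  by (auto simp: branch_def)

lemma branch_asym: "y \<in> branch x z \<Longrightarrow> y \<notin> branch z x"
  by (auto simp: branch_def)

lemma ex_branch:
  assumes "x \<in> V" "y \<in> V" "y \<noteq> x"
  obtains z where "(x, z) \<in> E" "y \<in> branch x z"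
  using dist_step[OF assms(1,2)] assms by (metis (mono_tags, lifting) branch_def mem_Collect_eq)

text \<open>If \<open>z\<close> and \<open>z'\<close> differed, \<open>z'\<close> would be on the
  side of \<open>x\<close> for the edge \<open>xz\<close>. The path from \<open>y\<close> to
  \<open>z'\<close> would then pass through \<open>x\<close>, although \<open>y\<close> is supposed
  to be nearer to \<open>z'\<close> than to \<open>x\<close>.\<close>

lemma branch_disjoint:
  assumes xz: "(x, z) \<in> E" "(x, z') \<in> E" and y: "y \<in> branch x z" "y \<in> branch x z'"
  shows "z = z'"
proof (rule ccontr)
  assume "z \<noteq> z'"
  then have "z' \<notin> branch x z"
    using branch_exit[OF xz(1) edge_sym[OF xz(2)]] not_in_own_branch by blast
  then have "z' \<in> branch z x" using branch_cases[OF xz(1)] xz(2) wellformed' by blast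
  then have "d y z' = Suc (d z y + d x z')" using dist_across[OF xz(1) y(1)] by simp
  moreover have "d y z' = d z' y" using dist_commute y branch_V xz(2) wellformed' by metis
  ultimately show False using branch_dist[OF y(1)] branch_dist[OF y(2)] by simp
qed

lemma branch_subset:
  assumes "(y, x) \<in> E" "(x, z) \<in> E" "z \<noteq> y"
  shows "branch x z \<subseteq> branch y x"
proof
  fix w assume w: "w \<in> branch x z"
  then have "w \<notin> branch x y"
    using branch_disjoint assms edge_sym by metis
  then show "w \<in> branch y x"
    using branch_cases[OF assms(1)] w branch_V by blast
qed

text \<open>Seen across the edge \<open>xz\<close>, the other branch lies on the side of
  \<open>x\<close>, so the path between the two passes through \<open>x\<close>.\<close>

lemma dist_branches:
  assumes "(x, z) \<in> E" "(x, z') \<in> E" "z \<noteq> z'" "w \<in> branch x z" "w' \<in> branch x z'"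
  shows "d w w' = d x w + d x w'"
proof -
  have "w' \<in> branch z x"
    using branch_subset[OF edge_sym[OF assms(1)] assms(2)] assms(3,5) by blast
  then show ?thesis
    using dist_across[OF assms(1,4)] branch_dist[OF assms(4)] by simp
qed

lemma geodesic:
  assumes "u \<in> V" "v \<in> V"
  obtains f where "f 0 = u" "f (d u v) = v"
    "\<And>i. i \<le> d u v \<Longrightarrow> f i \<in> V \<and> d u (f i) = i \<and> d (f i) v = d u v - i"
    "\<And>i. i < d u v \<Longrightarrow> (f i, f (Suc i)) \<in> E"
proof -
  \<comment> \<open>Prepending a vertex keeps the end \<open>v\<close> fixed, so the induction
    controls distances to \<open>v\<close> only; those from \<open>u\<close> follow by the triangle
    inequality.\<close>
  have "\<exists>f. f 0 = u \<and> f (d u v) = v \<and> (\<forall>i \<le> d u v. f i \<in> V \<and> d (f i) v = d u v - i)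
    \<and> (\<forall>i < d u v. (f i, f (Suc i)) \<in> E)"
    using assms
  proof (induction "d u v" arbitrary: u)
    case 0
    then have "u = v" using dist_eq_0_iff by metis
    then show ?case using 0 by (intro exI[of _ "\<lambda>_. u"]) auto
  next
    case (Suc n)
    then have "u \<noteq> v" by auto
    then obtain z where z: "(u, z) \<in> E" "d u v = Suc (d z v)"
      using dist_step Suc.prems by metis
    have "z \<in> V" using z wellformed' by auto
    then obtain g where g: "g 0 = z" "g (d z v) = v"
      "\<forall>i \<le> d z v. g i \<in> V \<and> d (g i) v = d z v - i" "\<forall>i < d z v. (g i, g (Suc i)) \<in> E"
      using Suc.hyps(1)[of z] Suc.hyps(2) Suc.prems z(2) by auto
    show ?case
      using g z Suc.prems by (intro exI[of _ "case_nat u g"]) (auto split: nat.split)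
  qed
  then obtain f where f: "f 0 = u" "f (d u v) = v"
    "\<And>i. i \<le> d u v \<Longrightarrow> f i \<in> V \<and> d (f i) v = d u v - i"
    "\<And>i. i < d u v \<Longrightarrow> (f i, f (Suc i)) \<in> E" by metis
  have "d u (f i) \<le> i" if "i \<le> d u v" for i
    using that
  proof (induction i)
    case 0
    then show ?case using f(1) assms by simp
  next
    case (Suc i)
    then have "d u (f (Suc i)) \<le> d u (f i) + d (f i) (f (Suc i))"
      using dist_triangle[of u "f i" "f (Suc i)"] f(3)[of i] f(3)[of "Suc i"] assms by simp
    then show ?case using Suc dist_edge[OF f(4)[of i]] by simp
  qed
  moreover have "d u v \<le> d u (f i) + (d u v - i)" if "i \<le> d u v" for i
    using dist_triangle[of u "f i" v] f(3)[OF that] assms by simp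
  ultimately have "d u (f i) = i" if "i \<le> d u v" for i
    using that by (metis add.commute add_diff_cancel_left' add_le_cancel_left le_add_diff_inverse2 le_antisym)
  then show thesis using that f by blast
qed

end

section \<open>The escape of the robber\<close>

text \<open>At most one of the three legs is deep now and at most one is the next to become deep, so
  some leg is neither. It stays so until the next deep moment, and only there a new leg has to be
  chosen.\<close>

lemma unscheduled_choice:
  fixes deep :: "nat \<Rightarrow> nat \<Rightarrow> bool"
  assumes unique: "\<And>i j t. i < 3 \<Longrightarrow> j < 3 \<Longrightarrow> deep i t \<Longrightarrow> deep j t \<Longrightarrow> i = j"
  shows "\<exists>i. \<forall>t. i t < 3 \<and> \<not> deep (i t) t \<and> \<not> deep (i t) (Suc t) \<and>
    (i (Suc t) = i t \<or> (\<exists>j<3. deep j (Suc t)))"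
proof -
  \<comment> \<open>Leg \<open>j\<close> is the deep one at the first deep moment after
    \<open>t\<close>. The choice thus looks into the future of the patrol, which the robber knows;
    if no deep moment follows, no leg satisfies \<open>nxt\<close>.\<close>
  define nxt where "nxt j t \<longleftrightarrow> (\<exists>s>t. deep j s \<and> (\<forall>s'. t < s' \<and> s' < s \<longrightarrow> (\<forall>l<3. \<not> deep l s')))"
    for j t
  have nxt_unique: "j = l" if jl: "j < 3" "l < 3" "nxt j t" "nxt l t" for j l t
  proof -
    obtain s where s: "s > t" "deep j s" "\<And>s' m. t < s' \<Longrightarrow> s' < s \<Longrightarrow> m < 3 \<Longrightarrow> \<not> deep m s'"
      using jl(3) unfolding nxt_def by metis
    obtain r where r: "r > t" "deep l r" "\<And>s' m. t < s' \<Longrightarrow> s' < r \<Longrightarrow> m < 3 \<Longrightarrow> \<not> deep m s'"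
      using jl(4) unfolding nxt_def by metis
    have "s = r"
      using s(3)[of r l] r(3)[of s j] s(1,2) r(1,2) jl(1,2) by (cases s r rule: linorder_cases) auto
    then show ?thesis using unique[of j l s] s(2) r(2) jl(1,2) by simp
  qed
  have fresh: "\<exists>i<3. \<not> deep i t \<and> \<not> nxt i t" for t
  proof (rule ccontr)
    assume "\<not> ?thesis"
    then have "\<forall>i<3. deep i t \<or> nxt i t" by blast
    then have "deep 0 t \<or> nxt 0 t" "deep 1 t \<or> nxt 1 t" "deep 2 t \<or> nxt 2 t" by simp_all
    then show False using unique[of 0 1 t] unique[of 0 2 t] unique[of 1 2 t]
        nxt_unique[of 0 1 t] nxt_unique[of 0 2 t] nxt_unique[of 1 2 t] by auto
  qed
  have "\<exists>i. \<forall>t. (i t < 3 \<and> \<not> deep (i t) t \<and> \<not> nxt (i t) t) \<and>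
    (i (Suc t) = i t \<or> (\<exists>j<3. deep j (Suc t)))"
  proof (rule dependent_nat_choice)
    show "\<exists>i<3. \<not> deep i 0 \<and> \<not> nxt i 0" by (rule fresh)
    fix i t assume i: "i < 3 \<and> \<not> deep i t \<and> \<not> nxt i t"
    show "\<exists>l. (l < 3 \<and> \<not> deep l (Suc t) \<and> \<not> nxt l (Suc t)) \<and> (l = i \<or> (\<exists>j<3. deep j (Suc t)))"
    proof (cases "\<exists>j<3. deep j (Suc t)")
      case True
      then show ?thesis using fresh[of "Suc t"] by blast
    next
      case False
      \<comment> \<open>With no leg deep at \<open>Suc t\<close>, the first deep moment after
        \<open>Suc t\<close> is also the first one after \<open>t\<close>, so the old choice stays
        valid.\<close>
      have "\<not> nxt i (Suc t)"
      proof
        assume "nxt i (Suc t)"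
        then obtain s where s: "s > Suc t" "deep i s"
          "\<forall>s'. Suc t < s' \<and> s' < s \<longrightarrow> (\<forall>l<3. \<not> deep l s')"
          unfolding nxt_def by blast
        have "\<not> deep l s'" if "t < s'" "s' < s" "l < 3" for s' l
          using s(3) False that by (cases "s' = Suc t") auto
        then have "nxt i t"
          unfolding nxt_def using s(1,2) by (intro exI[of _ s]) simp
        then show False using i by simp
      qed
      then show ?thesis using False i by blast
    qed
  qed
  then obtain i where i: "\<And>t. i t < 3" "\<And>t. \<not> deep (i t) t" "\<And>t. \<not> nxt (i t) t"
    "\<And>t. i (Suc t) = i t \<or> (\<exists>j<3. deep j (Suc t))" by metis
  have "\<not> deep (i t) (Suc t)" for t
    using i(3)[of t] unfolding nxt_def by (auto dest: spec[of _ "Suc t"])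
  then show ?thesis using i by blast
qed

section \<open>Escape on three legs of length \<open>2 * k + 2\<close>\<close>

context undir_tree
begin

lemma robber_escapes:
  fixes a :: "nat \<Rightarrow> 'a"
  assumes v: "v \<in> V" and a: "\<And>i. i < 3 \<Longrightarrow> a i \<in> V" "\<And>i. i < 3 \<Longrightarrow> d v (a i) = 2 * k + 2"
    "\<And>i j. i < 3 \<Longrightarrow> j < 3 \<Longrightarrow> i \<noteq> j \<Longrightarrow> d (a i) (a j) = 4 * k + 4"
    and c: "lazy_walk T c"
  shows "\<exists>r. lazy_walk T r \<and> \<not> captured T k c r"
proof -
  define L where "L = 2 * k + 2"
  have "\<exists>l. l 0 = v \<and> (\<forall>e\<le>L. l e \<in> V \<and> d (l e) (a i) = L - e) \<and> (\<forall>e<L. (l e, l (Suc e)) \<in> E)"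
    if "i < 3" for i
    using geodesic[OF v a(1)[OF that]] a(2)[OF that] unfolding L_def by metis
  then obtain l where l: "\<And>i. i < 3 \<Longrightarrow> l i 0 = v" "\<And>i e. i < 3 \<Longrightarrow> e \<le> L \<Longrightarrow> l i e \<in> V"
    "\<And>i e. i < 3 \<Longrightarrow> e \<le> L \<Longrightarrow> d (l i e) (a i) = L - e"
    "\<And>i e. i < 3 \<Longrightarrow> e < L \<Longrightarrow> (l i e, l i (Suc e)) \<in> E"
    by metis
  have cV: "c t \<in> V" for t using c by (simp add: lazy_walk_def)
  have c_step: "d (c t) (c (Suc t)) \<le> 1" for t
    using c cV dist_edge[of "c t" "c (Suc t)"] unfolding lazy_walk_def by (metis dist_self le_refl zero_le)
  define X where "X i t = int L - int (d (c t) (a i))" for i t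
  have X_step: "\<bar>X i (Suc t) - X i t\<bar> \<le> 1" if "i < 3" for i t
    using dist_triangle[OF cV[of t] cV[of "Suc t"] a(1)[OF that]]
      dist_triangle[OF cV[of "Suc t"] cV[of t] a(1)[OF that]]
      c_step[of t] dist_commute[OF cV[of "Suc t"] cV[of t]]
    unfolding X_def by linarith
  have X_sum: "X i t + X j t \<le> 0" if "i < 3" "j < 3" "i \<noteq> j" for i j t
    using dist_triangle[OF a(1)[OF that(1)] cV[of t] a(1)[OF that(2)]] a(3)[OF that]
      dist_commute[OF cV[of t] a(1)[OF that(1)]]
    unfolding X_def L_def by linarith
  \<comment> \<open>The threshold \<open>k + 2\<close> serves two ends. On a leg that is not deep,
    the depth \<open>k + 1 + X\<close> is at most \<open>2 * k + 2 = L\<close>. A deep leg pushes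
    the other coordinates to at most \<open>- k - 2\<close>, hence to at most \<open>- k - 1\<close>
    one move earlier or later, where that depth is not positive.\<close>
  define deep where "deep i t \<longleftrightarrow> int k + 2 \<le> X i t" for i t
  have deep_unique: "i = j" if "i < 3" "j < 3" "deep i t" "deep j t" for i j t
    using X_sum[of i j t] that unfolding deep_def by linarith
  have "\<exists>i. \<forall>t. i t < 3 \<and> \<not> deep (i t) t \<and> \<not> deep (i t) (Suc t) \<and>
    (i (Suc t) = i t \<or> (\<exists>j<3. deep j (Suc t)))"
    by (rule unscheduled_choice) (rule deep_unique)
  then obtain i where i: "\<And>t. i t < 3" "\<And>t. \<not> deep (i t) t" "\<And>t. \<not> deep (i t) (Suc t)"
    "\<And>t. i (Suc t) = i t \<or> (\<exists>j<3. deep j (Suc t))"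
    by metis
  \<comment> \<open>The maximum covers both cop positions that \<open>captured\<close> compares with
    \<open>r t\<close>. Truncation at 0 by \<open>nat\<close> lets the robber wait at
    \<open>v\<close>.\<close>
  define e where "e t = nat (int k + 1 + max (X (i t) t) (X (i t) (Suc t)))" for t
  have e_le: "e t \<le> L" for t
    using i(2,3)[of t] unfolding e_def L_def deep_def by linarith
  define r where "r t = l (i t) (e t)" for t
  have rV: "r t \<in> V" for t unfolding r_def using l(2) i(1) e_le by blast
  have r_step: "r (Suc t) = r t \<or> (r t, r (Suc t)) \<in> E" for t
  proof (cases "\<exists>j<3. deep j (Suc t)")
    case True
    then obtain j where j: "j < 3" "deep j (Suc t)" by blast
    then have ne: "j \<noteq> i t" "j \<noteq> i (Suc t)" using i(2,3) by auto
    have "X (i t) (Suc t) \<le> - int k - 2" "X (i (Suc t)) (Suc t) \<le> - int k - 2"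
      using X_sum[OF j(1) i(1) ne(1), of "Suc t"] X_sum[OF j(1) i(1) ne(2), of "Suc t"] j(2)
      unfolding deep_def by linarith+
    then have "e t = 0" "e (Suc t) = 0"
      using X_step[OF i(1)[of t], of t] X_step[OF i(1)[of "Suc t"], of "Suc t"]
      unfolding e_def by linarith+
    then show ?thesis by (simp add: r_def l(1) i(1))
  next
    case False
    then have eq: "i (Suc t) = i t" using i(4) by blast
    have "\<bar>int (e (Suc t)) - int (e t)\<bar> \<le> 1"
      using X_step[OF i(1)[of t], of t] X_step[OF i(1)[of t], of "Suc t"]
      unfolding e_def eq by linarith
    then consider "e (Suc t) = e t" | "e (Suc t) = Suc (e t)" | "e t = Suc (e (Suc t))" by linarith
    then show ?thesis
    proof cases
      case 1
      then show ?thesis by (simp add: r_def eq)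
    next
      case 2
      then show ?thesis using l(4)[OF i(1)[of t], of "e t"] e_le[of "Suc t"] by (simp add: r_def eq)
    next
      case 3
      then show ?thesis using edge_sym[OF l(4)[OF i(1)[of t], of "e (Suc t)"]] e_le[of t]
        by (simp add: r_def eq)
    qed
  qed
  \<comment> \<open>Comparing the distances of both players to the end \<open>a (i t)\<close> of the
    leg bounds their mutual distance below by \<open>e t - X (i t) s\<close>, wherever in the tree
    the cop is.\<close>
  have safe: "k < d (c s) (r t)" if "s = t \<or> s = Suc t" for s t
  proof -
    have "d (c s) (a (i t)) \<le> d (c s) (r t) + d (r t) (a (i t))"
      by (rule dist_triangle[OF cV rV a(1)[OF i(1)]])
    also have "d (r t) (a (i t)) = L - e t" unfolding r_def using l(3)[OF i(1) e_le] .
    finally have "int (e t) - X (i t) s \<le> int (d (c s) (r t))"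
      using e_le[of t] unfolding X_def by linarith
    moreover have "int k + 1 + X (i t) s \<le> int (e t)"
      using that unfolding e_def by auto
    ultimately show ?thesis by linarith
  qed
  have "lazy_walk T r" using rV r_step by (simp add: lazy_walk_def)
  moreover have "\<not> captured T k c r"
    unfolding captured_def using safe by (simp add: not_le)
  ultimately show ?thesis by blast
qed

end


section \<open>The sweep of the cop\<close>

context undir_tree
begin

abbreviation ball :: "nat \<Rightarrow> 'a \<Rightarrow> 'a set" where
  "ball k c \<equiv> {y \<in> V. d c y \<le> k}"

text \<open>\<open>clears k c Z\<close>: some finite patrol ends in \<open>c\<close>, and no uncaptured robber can be in \<open>Z\<close> after
  his reply to its last move.\<close>

inductive clears :: "nat \<Rightarrow> 'a \<Rightarrow> 'a set \<Rightarrow> bool" for k where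
  start: "c \<in> V \<Longrightarrow> clears k c (ball k c)"
| weaken: "clears k c Z \<Longrightarrow> Z' \<subseteq> Z \<Longrightarrow> clears k c Z'"
| move: "clears k c Z \<Longrightarrow> (c, c') \<in> E \<Longrightarrow> C \<subseteq> Z \<union> ball k c' \<Longrightarrow>
    (\<And>y y'. y \<in> C \<Longrightarrow> (y, y') \<in> E \<Longrightarrow> y' \<in> Z \<union> ball k c') \<Longrightarrow> clears k c' (C \<union> ball k c')"

text \<open>The finite patrol is prolonged by staying at its end. Up to the robber's reply to the
  last move, \<open>w i\<close> meets \<open>r i\<close> for \<open>i\<close> \<le>
  \<open>n\<close>, while \<open>w (Suc i)\<close> meets \<open>r i\<close> only for
  \<open>i < n\<close>; hence the two bounds.\<close>

lemma clears_patrol: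
  assumes "clears k c Z"
  shows "\<exists>w n. lazy_walk T w \<and> w n = c \<and>
    (\<forall>r. lazy_walk T r \<longrightarrow> (\<forall>i\<le>n. k < d (w i) (r i)) \<longrightarrow> (\<forall>i<n. k < d (w (Suc i)) (r i)) \<longrightarrow> r n \<notin> Z)"
  using assms
proof induction
  case (start c)
  then show ?case
    by (intro exI[of _ "\<lambda>_. c"] exI[of _ 0]) (auto simp: lazy_walk_def)
next
  case (weaken c Z Z')
  then obtain w n where "lazy_walk T w" "w n = c"
    "\<forall>r. lazy_walk T r \<longrightarrow> (\<forall>i\<le>n. k < d (w i) (r i)) \<longrightarrow> (\<forall>i<n. k < d (w (Suc i)) (r i)) \<longrightarrow> r n \<notin> Z"
    by metis
  then show ?case using weaken.hyps(2) by (intro exI[of _ w] exI[of _ n]) (simp, blast)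
next
  case (move c Z c' C)
  then obtain w n where w: "lazy_walk T w" "w n = c" and
    n: "\<And>r. lazy_walk T r \<Longrightarrow> (\<forall>i\<le>n. k < d (w i) (r i)) \<Longrightarrow> (\<forall>i<n. k < d (w (Suc i)) (r i)) \<Longrightarrow> r n \<notin> Z"
    by blast
  define w' where "w' i = (if i \<le> n then w i else c')" for i
  have c': "c' \<in> V" using move.hyps(2) wellformed' by blast
  have "w' (Suc i) = w' i \<or> (w' i, w' (Suc i)) \<in> E" for i
  proof -
    consider "i < n" | "i = n" | "n < i" by linarith
    then show ?thesis
    proof cases
      case 1
      then show ?thesis using w(1) by (simp add: lazy_walk_def w'_def)
    next
      case 2
      then show ?thesis using w(2) move.hyps(2) by (simp add: w'_def)
    next
      case 3
      then show ?thesis by (simp add: w'_def)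
    qed
  qed
  moreover have "w' i \<in> V" for i
    using w(1) c' by (simp add: lazy_walk_def w'_def)
  ultimately have "lazy_walk T w'" by (simp add: lazy_walk_def)
  moreover have "r (Suc n) \<notin> C \<union> ball k c'"
    if r: "lazy_walk T r" "\<forall>i\<le>Suc n. k < d (w' i) (r i)" "\<forall>i<Suc n. k < d (w' (Suc i)) (r i)" for r
  proof -
    have "r n \<notin> Z"
    proof (rule n[OF r(1)])
      show "\<forall>i\<le>n. k < d (w i) (r i)"
      proof (intro allI impI)
        fix i assume "i \<le> n"
        then show "k < d (w i) (r i)" using r(2)[rule_format, of i] by (simp add: w'_def)
      qed
      show "\<forall>i<n. k < d (w (Suc i)) (r i)"
      proof (intro allI impI)
        fix i assume "i < n"
        then show "k < d (w (Suc i)) (r i)" using r(3)[rule_format, of i] by (simp add: w'_def)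
      qed
    qed
    moreover have "k < d c' (r n)" "k < d c' (r (Suc n))"
      using r(2)[rule_format, of "Suc n"] r(3)[rule_format, of n] by (simp_all add: w'_def)
    moreover have "r (Suc n) = r n \<or> (r (Suc n), r n) \<in> E" "r n \<in> V"
      using r(1) edge_sym[of "r n" "r (Suc n)"] by (auto simp: lazy_walk_def)
    \<comment> \<open>The \<open>move\<close> rule is read backwards: a robber now in
      \<open>C\<close> stood before his reply in \<open>Z\<close> or within \<open>k\<close> of
      \<open>c'\<close>, and both have been excluded.\<close>
    ultimately show ?thesis
      using move.hyps(3) move.hyps(4)[of "r (Suc n)" "r n"] by (auto simp: subset_iff)
  qed
  moreover have "w' (Suc n) = c'" by (simp add: w'_def)
  ultimately show ?case by (intro exI[of _ w'] exI[of _ "Suc n"] conjI allI impI) simp_all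
qed

lemma clears_winning:
  assumes "clears k c V"
  shows "\<exists>w. winning_patrol T k w"
proof -
  obtain w n where w: "lazy_walk T w" and
    n: "\<And>r. lazy_walk T r \<Longrightarrow> (\<forall>i\<le>n. k < d (w i) (r i)) \<Longrightarrow> (\<forall>i<n. k < d (w (Suc i)) (r i)) \<Longrightarrow> r n \<notin> V"
    using clears_patrol[OF assms] by blast
  have "captured T k w r" if r: "lazy_walk T r" for r
  proof (rule ccontr)
    assume "\<not> captured T k w r"
    then have "r n \<notin> V"
      by (intro n[OF r]) (simp_all add: captured_def not_le)
    then show False using r by (simp add: lazy_walk_def)
  qed
  with w have "winning_patrol T k w" by (simp add: winning_patrol_def)
  then show ?thesis by (rule exI[of _ w])
qed

text \<open>Here \<open>j\<close> is the depth of \<open>x\<close> below the foot of the searched branch, and \<open>A\<close> consists of the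
  vertices between the foot and \<open>x\<close>, which separate the cleared part \<open>C\<close> from the rest.\<close>

lemma clear_branches:
  assumes "x \<in> V" "j \<le> k"
    and "\<And>a. a \<in> A \<Longrightarrow> a \<in> V \<and> d a x \<le> j"
    and "\<And>y y'. y \<in> C \<Longrightarrow> (y, y') \<in> E \<Longrightarrow> y' \<in> C \<union> insert x A"
    and "clears k x (C \<union> ball k x)"
    and "\<And>z. z \<in> F \<Longrightarrow> (x, z) \<in> E"
    and "\<And>z w. z \<in> F \<Longrightarrow> w \<in> branch x z \<Longrightarrow> d x w + j \<le> 2 * k + 1"
  shows "clears k x (C \<union> (\<Union>z\<in>F. branch x z) \<union> ball k x)"
  using assms
\<comment> \<open>The outer induction descends into the branches; the inner one runs through the
  children \<open>F\<close> to be searched at \<open>x\<close>.\<close>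
proof (induction "k - j" arbitrary: x j A C F rule: less_induct)
  case less
  have A_ball: "insert x A \<subseteq> ball k x"
  proof
    fix a assume "a \<in> insert x A"
    then show "a \<in> ball k x"
      using less.prems(1,2) less.prems(3)[of a] dist_commute[of a x] by auto
  qed
  have "finite F"
    using less.prems(6) in_arcsD2 pair_finite_verts by (meson finite_subset subsetI)
  then show ?case
    using less.prems(6,7)
  proof (induction F)
    case empty
    then show ?case using less.prems(5) by simp
  next
    case (insert z F)
    define C1 where "C1 = C \<union> (\<Union>z\<in>F. branch x z)"
    have xz: "(x, z) \<in> E" using insert.prems(1) by simp
    have zV: "z \<in> V" using xz wellformed' by blast
    have C1: "clears k x (C1 \<union> ball k x)"
      unfolding C1_def using insert.IH insert.prems by auto
    have C1_closed: "y' \<in> C1 \<union> insert x A" if y: "y \<in> C1" "(y, y') \<in> E" for y y'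
    proof (cases "y \<in> C")
      case True
      then show ?thesis using less.prems(4)[OF _ y(2)] by (auto simp: C1_def)
    next
      case False
      then obtain u where u: "u \<in> F" "y \<in> branch x u" using y(1) by (auto simp: C1_def)
      then have "y' \<in> branch x u \<or> y' = x"
        using branch_exit[OF _ y(2) u(2)] insert.prems(1) by blast
      then show ?thesis using u by (auto simp: C1_def)
    qed
    \<comment> \<open>A robber who re-enters the cleared part during this move comes from
      \<open>insert x A\<close>, which lies within \<open>k\<close> of \<open>x\<close>, so he was
      captured before. This holds even for \<open>j = k\<close>, when the foot may be at distance
      \<open>k + 1\<close> from \<open>z\<close>.\<close>
    have at_z: "clears k z (C1 \<union> ball k z)"
    proof (rule clears.move[OF C1 xz])
      show "C1 \<subseteq> C1 \<union> ball k x \<union> ball k z" by blast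
      show "y' \<in> C1 \<union> ball k x \<union> ball k z" if "y \<in> C1" "(y, y') \<in> E" for y y'
        using C1_closed[OF that] A_ball by blast
    qed
    have "clears k z (C1 \<union> branch x z \<union> ball k z)"
    proof (cases "j = k")
      case True
      \<comment> \<open>For \<open>j = k\<close> the height bound leaves at most \<open>k\<close>
        levels below \<open>z\<close>, so the search stops here.\<close>
      have "branch x z \<subseteq> ball k z"
      proof
        fix w assume w: "w \<in> branch x z"
        then have "d x w + k \<le> 2 * k + 1" using insert.prems(2)[of z w] True by simp
        then show "w \<in> ball k z" using branch_dist[OF w] branch_V[OF w] by simp
      qed
      then show ?thesis using at_z by (simp add: Un_absorb1 sup_assoc)
    next
      case False
      \<comment> \<open>The barrier grows by \<open>x\<close> and the depth by one, while heights
        seen from \<open>z\<close> drop by one, so the bound \<open>2 * k + 1\<close> is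
        preserved.\<close>
      let ?F = "{z'. (z, z') \<in> E \<and> z' \<noteq> x}"
      have "clears k z (C1 \<union> (\<Union>z'\<in>?F. branch z z') \<union> ball k z)"
      proof (rule less.hyps[of "Suc j" z "insert x A"])
        show "k - Suc j < k - j" "Suc j \<le> k" using False less.prems(2) by simp_all
        show "z \<in> V" by (rule zV)
        show "a \<in> V \<and> d a z \<le> Suc j" if "a \<in> insert x A" for a
        proof -
          have "a \<in> V \<and> d a x \<le> j" using that less.prems(1) less.prems(3)[of a] by auto
          then show ?thesis
            using dist_triangle[of a x z] dist_edge[OF xz] less.prems(1) zV by simp
        qed
        show "y' \<in> C1 \<union> insert z (insert x A)" if "y \<in> C1" "(y, y') \<in> E" for y y'
          using C1_closed[OF that] by blast
        show "clears k z (C1 \<union> ball k z)" by (rule at_z)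
        show "(z, z') \<in> E" if "z' \<in> ?F" for z' using that by simp
        show "d z w + Suc j \<le> 2 * k + 1" if "z' \<in> ?F" "w \<in> branch z z'" for z' w
        proof -
          have w: "w \<in> branch x z" using branch_subset[OF xz, of z'] that by blast
          then show ?thesis using insert.prems(2)[of z w] branch_dist[OF w] by simp
        qed
      qed
      moreover have "branch x z \<subseteq> insert z (\<Union>z'\<in>?F. branch z z')"
      proof
        fix w assume w: "w \<in> branch x z"
        show "w \<in> insert z (\<Union>z'\<in>?F. branch z z')"
        proof (cases "w = z")
          case False
          then obtain z' where "(z, z') \<in> E" "w \<in> branch z z'"
            using ex_branch[OF zV branch_V[OF w]] by blast
          then show ?thesis using branch_asym[OF w] by blast
        qed simp
      qed
      moreover have "z \<in> ball k z" using zV by simp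
      ultimately show ?thesis by (elim clears.weaken) blast
    qed
    \<comment> \<open>The searched part can be entered only from \<open>x\<close> and
      \<open>A\<close>, which are all within \<open>k\<close> of the cop once he is back at
      \<open>x\<close>.\<close>
    then have "clears k x ((C1 \<union> branch x z) \<union> ball k x)"
    proof (rule clears.move[OF _ edge_sym[OF xz]])
      show "C1 \<union> branch x z \<subseteq> C1 \<union> branch x z \<union> ball k z \<union> ball k x" by blast
      show "y' \<in> C1 \<union> branch x z \<union> ball k z \<union> ball k x"
        if y: "y \<in> C1 \<union> branch x z" "(y, y') \<in> E" for y y'
        using C1_closed[OF _ y(2)] branch_exit[OF xz y(2)] y(1) A_ball by blast
    qed
    then show ?case unfolding C1_def by (elim clears.weaken) blast
  qed
qed

section \<open>The patrol along a diametral path\<close>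

lemma ex_diameter:
  obtains a b where "a \<in> V" "b \<in> V" "\<And>x y. x \<in> V \<Longrightarrow> y \<in> V \<Longrightarrow> d x y \<le> d a b"
proof -
  let ?D = "case_prod d ` (V \<times> V)"
  have fin: "finite ?D" using pair_finite_verts by simp
  then have "Max ?D \<in> ?D" using V_nonempty by (intro Max_in) auto
  then obtain a b where ab: "a \<in> V" "b \<in> V" "d a b = Max ?D" by force
  have "d x y \<le> d a b" if "x \<in> V" "y \<in> V" for x y
    unfolding ab(3) using fin that by (intro Max_ge) auto
  then show thesis using ab that by blast
qed

text \<open>For positive \<open>L\<close> this is equivalent to \<open>L\<close> \<le>
  \<open>ell3 T v\<close>, by \<open>le_ell3\<close> and \<open>three_branches_ell3\<close>. Both
  players' arguments use branches and far vertices instead of induced subgraphs.\<close>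

definition three_branches :: "nat \<Rightarrow> 'a \<Rightarrow> bool" where
  "three_branches L v \<longleftrightarrow> (\<exists>u w :: nat \<Rightarrow> 'a. inj_on u {..<3} \<and>
     (\<forall>i<3. (v, u i) \<in> E \<and> w i \<in> branch v (u i) \<and> L \<le> d v (w i)))"

lemma three_branchesI:
  assumes "(v, u1) \<in> E" "w1 \<in> branch v u1" "L \<le> d v w1"
    and "(v, u2) \<in> E" "w2 \<in> branch v u2" "L \<le> d v w2"
    and "(v, u3) \<in> E" "w3 \<in> branch v u3" "L \<le> d v w3"
    and "u1 \<noteq> u2" "u1 \<noteq> u3" "u2 \<noteq> u3"
  shows "three_branches L v"
proof -
  define u where "u i = (if i = 0 then u1 else if i = 1 then u2 else u3)" for i :: nat
  define w where "w i = (if i = 0 then w1 else if i = 1 then w2 else w3)" for i :: nat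
  have cases3: "i = 0 \<or> i = 1 \<or> i = 2" if "i < 3" for i :: nat
    using that by linarith
  have "inj_on u {..<3}"
  proof (rule inj_onI)
    fix i j assume "i \<in> {..<3}" "j \<in> {..<3}" "u i = u j"
    then show "i = j"
      using cases3[of i] cases3[of j] assms(10-12) by (auto simp: u_def split: if_splits)
  qed
  moreover have "(v, u i) \<in> E \<and> w i \<in> branch v (u i) \<and> L \<le> d v (w i)" if "i < 3" for i
    using cases3[OF that] assms(1-9) by (elim disjE) (simp_all add: u_def w_def)
  ultimately show ?thesis
    unfolding three_branches_def by (intro exI[of _ u] exI[of _ w] conjI allI impI) simp_all
qed

lemma cop_wins:
  assumes no_branches: "\<And>v. v \<in> V \<Longrightarrow> \<not> three_branches (2 * k + 2) v"
  shows "\<exists>c. winning_patrol T k c"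
proof -
  obtain a b where ab: "a \<in> V" "b \<in> V" and diam: "\<And>x y. x \<in> V \<Longrightarrow> y \<in> V \<Longrightarrow> d x y \<le> d a b"
    using ex_diameter by metis
  define n where "n = d a b"
  obtain f where f: "f 0 = a" "f n = b" "\<And>i. i \<le> n \<Longrightarrow> f i \<in> V"
    "\<And>i. i \<le> n \<Longrightarrow> d a (f i) = i" "\<And>i. i \<le> n \<Longrightarrow> d (f i) b = n - i"
    "\<And>i. i < n \<Longrightarrow> (f i, f (Suc i)) \<in> E"
    using geodesic[OF ab] unfolding n_def by metis
  have a_branch: "a \<in> branch (f (Suc i)) (f i)" if "i < n" for i
    using that f(3)[of i] f(3)[of "Suc i"] f(4)[of i] f(4)[of "Suc i"] ab
    by (simp add: branch_def dist_commute[of _ a])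
  have b_branch: "b \<in> branch (f i) (f (Suc i))" if "i < n" for i
    using that f(5)[of i] f(5)[of "Suc i"] ab by (simp add: branch_def)
  \<comment> \<open>The guards treat the ends of the path, where one path neighbour is missing; at
    \<open>i = 0\<close> the term \<open>f (i - 1)\<close> would be \<open>f 0\<close>
    itself.\<close>
  define side where "side i = {z. (f i, z) \<in> E \<and> (i < n \<longrightarrow> z \<noteq> f (Suc i)) \<and> (0 < i \<longrightarrow> z \<noteq> f (i - 1))}"
    for i
  have side_le: "d (f i) w + 0 \<le> 2 * k + 1" if i: "i \<le> n" and z: "z \<in> side i" and w: "w \<in> branch (f i) z"
    for i z w
  proof (rule ccontr)
    assume "\<not> ?thesis"
    then have far: "2 * k + 2 \<le> d (f i) w" by simp
    have z': "(f i, z) \<in> E" "i < n \<Longrightarrow> z \<noteq> f (Suc i)" "0 < i \<Longrightarrow> z \<noteq> f (i - 1)"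
      using z by (auto simp: side_def)
    have prev: "(f i, f (i - 1)) \<in> E" "a \<in> branch (f i) (f (i - 1))" if "0 < i"
      using edge_sym[OF f(6)[of "i - 1"]] a_branch[of "i - 1"] i that by simp_all
    have wb: "d w b = d (f i) w + (n - i)"
    proof (cases "i < n")
      case True
      then show ?thesis
        using dist_branches[OF z'(1) f(6)[OF True] z'(2)[OF True] w b_branch[OF True]] f(5)[OF i] by simp
    next
      case False
      then show ?thesis using i f(2) dist_commute[OF ab(2) branch_V[OF w]] by simp
    qed
    have wa: "d w a = d (f i) w + i"
    proof (cases "0 < i")
      case True
      then show ?thesis
        using dist_branches[OF z'(1) prev(1) z'(3) w prev(2)] f(4)[OF i]
          dist_commute[OF f(3)[OF i] ab(1)] by simp
    next
      case False
      then show ?thesis using i f(1) dist_commute[OF ab(1) branch_V[OF w]] by simp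
    qed
    \<comment> \<open>By maximality of the diameter, both ends of the path are at least as far from
      \<open>f i\<close> as \<open>w\<close> is, so \<open>f i\<close> would have three long
      branches.\<close>
    have "d w a \<le> n" "d w b \<le> n" unfolding n_def by (rule diam[OF branch_V[OF w]], fact ab)+
    then have in': "2 * k + 2 \<le> i" "2 * k + 2 \<le> n - i" using wa wb far i by linarith+
    then have i': "0 < i" "i < n" by linarith+
    have "d a (f (i - 1)) = i - 1" "d a (f (Suc i)) = Suc i" using f(4) i' by simp_all
    then have "f (i - 1) \<noteq> f (Suc i)" by (metis diff_le_self Suc_n_not_le_n)
    moreover have "z \<noteq> f (i - 1)" "z \<noteq> f (Suc i)" using z' i' by simp_all
    moreover have "2 * k + 2 \<le> d (f i) a" "2 * k + 2 \<le> d (f i) b"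
      using in' f(4,5)[OF i] dist_commute[OF f(3)[OF i] ab(1)] by simp_all
    ultimately have "three_branches (2 * k + 2) (f i)"
      using three_branchesI[OF z'(1) w far prev(1)[OF i'(1)] prev(2)[OF i'(1)] _ f(6)[OF i'(2)] b_branch[OF i'(2)]]
      by simp
    then show False using no_branches[OF f(3)[OF i]] by simp
  qed
  define behind where "behind i = (if i = 0 then {} else branch (f i) (f (i - 1)))" for i
  have cleared: "clears k (f i) (behind i \<union> (\<Union>z\<in>side i. branch (f i) z) \<union> ball k (f i))"
    if "i \<le> n" "clears k (f i) (behind i \<union> ball k (f i))" for i
  \<comment> \<open>The foot is the path vertex itself: depth 0 and an empty barrier.\<close>
  proof (rule clear_branches[of _ 0 _ "{}"])
    show "y' \<in> behind i \<union> {f i}" if y: "y \<in> behind i" "(y, y') \<in> E" for y y'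
    proof -
      have "0 < i" "y \<in> branch (f i) (f (i - 1))" using y(1) by (auto simp: behind_def split: if_splits)
      moreover have "(f i, f (i - 1)) \<in> E"
        using edge_sym[OF f(6)[of "i - 1"]] \<open>0 < i\<close> \<open>i \<le> n\<close> by simp
      ultimately show ?thesis using branch_exit[OF _ y(2)] by (auto simp: behind_def)
    qed
    show "(f i, z) \<in> E" if "z \<in> side i" for z using that by (simp add: side_def)
    show "d (f i) w + 0 \<le> 2 * k + 1" if "z \<in> side i" "w \<in> branch (f i) z" for z w
      using side_le[OF \<open>i \<le> n\<close> that] .
    show "f i \<in> V" using f(3) \<open>i \<le> n\<close> .
  qed (use that in simp_all)
  have covered: "w \<in> behind i \<union> (\<Union>z\<in>side i. branch (f i) z) \<union> ball k (f i)"
    if i: "i \<le> n" and w: "w \<in> V" "i < n \<Longrightarrow> w \<notin> branch (f i) (f (Suc i))" for i w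
  proof (cases "w = f i")
    case True
    then show ?thesis using w(1) by simp
  next
    case False
    then obtain z where z: "(f i, z) \<in> E" "w \<in> branch (f i) z"
      using ex_branch[OF f(3)[OF i] w(1)] by blast
    then have "i < n \<longrightarrow> z \<noteq> f (Suc i)" using w(2) by blast
    then show ?thesis using z by (cases "0 < i \<and> z = f (i - 1)") (auto simp: side_def behind_def)
  qed
  have along: "clears k (f i) (behind i \<union> ball k (f i))" if "i \<le> n" for i
    using that
  proof (induction i)
    case 0
    then show ?case using clears.start[OF f(3)] by (simp add: behind_def)
  next
    case (Suc i)
    then have edge: "(f i, f (Suc i)) \<in> E" using f(6) by simp
    let ?Z = "behind i \<union> (\<Union>z\<in>side i. branch (f i) z) \<union> ball k (f i)"
    have sub: "branch (f (Suc i)) (f i) \<subseteq> ?Z"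
      using covered[of i] Suc.prems branch_V branch_asym by (meson Suc_leD subsetI)
    \<comment> \<open>The part behind can be re-entered only from \<open>f (Suc i)\<close>, the new
      position of the cop.\<close>
    have "clears k (f (Suc i)) (branch (f (Suc i)) (f i) \<union> ball k (f (Suc i)))"
    proof (rule clears.move[OF cleared edge])
      show "y' \<in> ?Z \<union> ball k (f (Suc i))" if y: "y \<in> branch (f (Suc i)) (f i)" "(y, y') \<in> E" for y y'
      proof (cases "y' \<in> branch (f (Suc i)) (f i)")
        case True
        then show ?thesis using sub by blast
      next
        case False
        then have "y' = f (Suc i)" using branch_exit[OF edge_sym[OF edge] y(2) y(1)] by simp
        then show ?thesis using f(3)[OF Suc.prems] by simp
      qed
    qed (use Suc sub in auto)
    then show ?case by (simp add: behind_def)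
  qed
  \<comment> \<open>At \<open>i = n\<close> no branch lies ahead, so \<open>covered\<close> exhausts
    the tree.\<close>
  have "clears k (f n) V"
    using cleared[OF _ along, of n] covered[of n] by (auto elim!: clears.weaken)
  then show ?thesis by (rule clears_winning)
qed

end


section \<open>Triods and branches\<close>

context undir_tree
begin

lemma out_degree_eq: "out_degree (with_proj T) x = card {y. (x, y) \<in> E}"
proof -
  have "out_arcs (with_proj T) x = Pair x ` {y. (x, y) \<in> E}"
    by (force simp: out_arcs_def)
  then show ?thesis
    by (simp add: out_degree_def card_image inj_on_def)
qed

lemma leaves_iff: "x \<in> leaves T \<longleftrightarrow> x \<in> V \<and> card {y. (x, y) \<in> E} = 1"
  by (simp add: leaves_def out_degree_eq)

lemma finite_leaves: "finite (leaves T)"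
  using pair_finite_verts by (simp add: leaves_def)

text \<open>A shortest path \<open>x\<close>, \<open>x1\<close>, \<open>x2\<close>, ... in
  \<open>H\<close> never turns back. By induction \<open>y\<close> lies beyond \<open>x2\<close> as
  seen from \<open>x1\<close>, hence not on the side of \<open>x\<close>, so the step from
  \<open>x\<close> to \<open>x1\<close> approaches \<open>y\<close> in the whole tree as
  well.\<close>

lemma dist_subtree:
  assumes "undir_tree H" and sub: "pverts H \<subseteq> V" "parcs H \<subseteq> E"
    and "x \<in> pverts H" "y \<in> pverts H"
  shows "graph_dist H x y = d x y"
proof -
  interpret H: undir_tree H by fact
  show ?thesis
    using assms(4)
  proof (induction "graph_dist H x y" arbitrary: x rule: less_induct)
    case less
    have xy: "x \<in> V" "y \<in> V" using less.prems assms(5) sub(1) by blast+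
    show ?case
    proof (cases "x = y")
      case True
      then show ?thesis using H.dist_self[OF assms(5)] dist_self[OF xy(2)] by simp
    next
      case False
      then obtain x1 where x1: "(x, x1) \<in> parcs H" "graph_dist H x y = Suc (graph_dist H x1 y)"
        using H.dist_step[OF less.prems assms(5)] by metis
      have x1V: "x1 \<in> pverts H" using H.in_arcsD2[OF x1(1)] .
      have IH1: "graph_dist H x1 y = d x1 y" using less.hyps[OF _ x1V] x1(2) by simp
      have e1: "(x, x1) \<in> E" using x1(1) sub(2) by blast
      show ?thesis
      proof (cases "x1 = y")
        case True
        then show ?thesis using x1(2) H.dist_self[OF assms(5)] dist_edge[OF e1] by simp
      next
        case False
        then obtain x2 where x2: "(x1, x2) \<in> parcs H" "graph_dist H x1 y = Suc (graph_dist H x2 y)"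
          using H.dist_step[OF x1V assms(5)] by metis
        have "x2 \<in> pverts H" using H.in_arcsD2[OF x2(1)] .
        then have "graph_dist H x2 y = d x2 y" using less.hyps x1(2) x2(2) by simp
        then have y: "y \<in> branch x1 x2" using IH1 x2(2) xy(2) by (simp add: branch_def)
        have "x \<noteq> x2" using x1(2) x2(2) by (metis n_not_Suc_n Suc_n_not_le_n le_SucI order_refl)
        moreover have "(x1, x2) \<in> E" using x2(1) sub(2) by blast
        ultimately have "y \<notin> branch x1 x" using branch_disjoint[OF edge_sym[OF e1] _ _ y] by metis
        then have "y \<in> branch x x1" using branch_cases[OF e1 xy(2)] by simp
        then show ?thesis using branch_dist x1(2) IH1 by simp
      qed
    qed
  qed
qed

text \<open>A vertex of the branch farthest from \<open>v\<close> is a leaf: any neighbour other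
  than the one towards \<open>v\<close> would be farther and still in the branch.\<close>

lemma leaf_in_branch:
  assumes vz: "(v, z) \<in> E"
  obtains w where "w \<in> branch v z" "w \<in> leaves T"
proof -
  have v: "v \<in> V" using in_arcsD1[OF vz] .
  have "finite (branch v z)" using pair_finite_verts by (simp add: branch_def)
  then have fin: "finite (d v ` branch v z)" by simp
  moreover have "d v ` branch v z \<noteq> {}" using neighbour_in_branch[OF vz] by blast
  ultimately have "Max (d v ` branch v z) \<in> d v ` branch v z" by (rule Max_in)
  then obtain w where w: "Max (d v ` branch v z) = d v w" "w \<in> branch v z" by (rule imageE)
  have max: "d v y \<le> d v w" if "y \<in> branch v z" for y
    unfolding w(1)[symmetric] using fin that by simp
  note w = w(2)
  have wV: "w \<in> V" using branch_V[OF w] .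
  have "w \<noteq> v" using w not_in_own_branch by metis
  then obtain y0 where y0: "(w, y0) \<in> E" "v \<in> branch w y0"
    using ex_branch[OF wV v] by metis
  have "y = y0" if y: "(w, y) \<in> E" for y
  proof (rule ccontr)
    assume "y \<noteq> y0"
    then have "v \<notin> branch w y" using branch_disjoint[OF y y0(1) _ y0(2)] by metis
    then have "v \<in> branch y w" using branch_cases[OF y v] by simp
    then have far: "d y v = Suc (d w v)" by (rule branch_dist)
    then have "y \<noteq> v" using v by auto
    then have "y \<in> branch v z" using branch_exit[OF vz y w] by metis
    then show False using max[of y] far dist_commute[OF v wV] dist_commute[OF v branch_V, of y] by simp
  qed
  then have "{y. (w, y) \<in> E} = {y0}" using y0(1) by blast
  then have "w \<in> leaves T" using wV by (simp add: leaves_iff)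
  then show thesis using that w by metis
qed

text \<open>Every neighbour of the origin in \<open>H\<close> leads to a leaf of \<open>H\<close>,
  and distances in \<open>H\<close> are those of the tree, so these leaves are the far
  vertices.\<close>

lemma triod_imp_three_branches:
  assumes ind: "induced_subgraph (with_proj H) (with_proj T)" and H: "triod H v"
  shows "three_branches (triod_ell3 H v) v"
proof -
  have sub: "pverts H \<subseteq> V" "parcs H \<subseteq> E"
    using ind by (simp_all add: induced_subgraph_def subgraph_def)
  have tree_H: "undir_tree H" using H by (simp add: triod_def undirected_tree_iff)
  interpret H: undir_tree H by (rule tree_H)
  have v: "v \<in> pverts H" and deg: "card {y. (v, y) \<in> parcs H} = 3"
    using H by (simp_all add: triod_def H.out_degree_eq)
  have "finite {y. (v, y) \<in> parcs H}" by (rule card_ge_0_finite) (simp add: deg)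
  from ex_bij_betw_nat_finite[OF this]
  obtain u where u: "bij_betw u {0..<3::nat} {y. (v, y) \<in> parcs H}" unfolding deg ..
  have vu: "(v, u i) \<in> parcs H" if "i < 3" for i
    using bij_betwE[OF u] that by simp
  have "\<exists>w. w \<in> branch v (u i) \<and> triod_ell3 H v \<le> d v w" if i: "i < 3" for i
  proof -
    obtain w where w: "w \<in> H.branch v (u i)" "w \<in> leaves H"
      using H.leaf_in_branch[OF vu[OF i]] by metis
    have uw: "w \<in> pverts H" "u i \<in> pverts H"
      using H.branch_V[OF w(1)] H.in_arcsD2[OF vu[OF i]] .
    have dist: "graph_dist H v w = d v w" "graph_dist H (u i) w = d (u i) w"
      using dist_subtree[OF tree_H sub] v uw by simp_all
    have "w \<in> branch v (u i)"
      using H.branch_dist[OF w(1)] dist uw(1) sub(1) by (simp add: branch_def subset_iff)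
    moreover have "triod_ell3 H v \<le> graph_dist H v w"
      unfolding triod_ell3_def using H.finite_leaves w(2) by (intro Min_le) simp_all
    ultimately show ?thesis using dist(1) by metis
  qed
  then obtain w where "\<And>i. i < 3 \<Longrightarrow> w i \<in> branch v (u i) \<and> triod_ell3 H v \<le> d v (w i)"
    by metis
  moreover have "inj_on u {..<3}"
    using bij_betw_imp_inj_on[OF u] by (simp add: atLeast0LessThan)
  ultimately show ?thesis
    unfolding three_branches_def using vu sub(2)
    by (intro exI[of _ u] exI[of _ w] conjI allI impI) (simp_all add: subset_iff)
qed

text \<open>The three paths from \<open>v\<close> to the far vertices together induce the
  triod.\<close>

lemma three_branches_imp_triod:
  assumes "three_branches L v"
  obtains H where "induced_subgraph (with_proj H) (with_proj T)" "triod H v" "L \<le> triod_ell3 H v"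
proof -
  obtain u w :: "nat \<Rightarrow> 'a" where inj: "inj_on u {..<3}" and vu: "\<And>i. i < 3 \<Longrightarrow> (v, u i) \<in> E"
    and w: "\<And>i. i < 3 \<Longrightarrow> w i \<in> branch v (u i)" and L: "\<And>i. i < 3 \<Longrightarrow> L \<le> d v (w i)"
    using assms unfolding three_branches_def by metis
  have v: "v \<in> V" using in_arcsD1[OF vu[of 0]] by simp
  have wV: "w i \<in> V" if "i < 3" for i using branch_V[OF w[OF that]] .
  \<comment> \<open>The vertices of the path from \<open>v\<close> to \<open>w i\<close>, given as a
    metric interval.\<close>
  define P where "P i = {x \<in> V. d v x + d x (w i) = d v (w i)}" for i
  define W where "W = (\<Union>i<3. P i)"
  define H where "H = \<lparr>pverts = W, parcs = {(x, y) \<in> E. x \<in> W \<and> y \<in> W}\<rparr>"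
  have H_simps: "pverts H = W" "\<And>x y. (x, y) \<in> parcs H \<longleftrightarrow> (x, y) \<in> E \<and> x \<in> W \<and> y \<in> W"
    by (simp_all add: H_def)
  have P_V: "x \<in> V" if "x \<in> P i" for x i using that by (simp add: P_def)
  have W_V: "W \<subseteq> V" using P_V by (auto simp: W_def)
  have P_W: "x \<in> W" if "x \<in> P i" "i < 3" for x i using that by (auto simp: W_def)
  have v_P: "v \<in> P i" if "i < 3" for i using v by (simp add: P_def)
  have w_P: "w i \<in> P i" if "i < 3" for i using wV[OF that] by (simp add: P_def)
  have v_W: "v \<in> W" using P_W[OF v_P, of 0] by simp
  \<comment> \<open>Apart from \<open>v\<close>, the path lies in the branch of \<open>u i\<close>,
    whence distinct paths meet only in \<open>v\<close>.\<close>
  have P_branch: "x \<in> branch v (u i)" if x: "x \<in> P i" "x \<noteq> v" and i: "i < 3" for x i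
  proof -
    obtain z where z: "(v, z) \<in> E" "x \<in> branch v z"
      using ex_branch[OF v P_V[OF x(1)] x(2)] by metis
    have "z = u i"
    proof (rule ccontr)
      assume "z \<noteq> u i"
      then have "d x (w i) = d v x + d v (w i)"
        by (rule dist_branches[OF z(1) vu[OF i] _ z(2) w[OF i]])
      then have "d v x = 0" using x(1) by (simp add: P_def)
      then show False using dist_eq_0_iff[OF v P_V[OF x(1)]] x(2) by simp
    qed
    then show ?thesis using z(2) by simp
  qed
  have P_unique: "i = j" if x: "x \<in> P i" "x \<in> P j" "x \<noteq> v" and ij: "i < 3" "j < 3" for x i j
  proof -
    have "u i = u j"
      using P_branch[OF x(1,3) ij(1)] P_branch[OF x(2,3) ij(2)]
      by (rule branch_disjoint[OF vu[OF ij(1)] vu[OF ij(2)]])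
    then show ?thesis using ij by (intro inj_onD[OF inj]) simp_all
  qed
  have P_step: "q \<in> P i" if x: "x \<in> P i" and q: "(x, q) \<in> E" "v \<in> branch x q \<or> w i \<in> branch x q"
    and i: "i < 3" for x q i
  proof -
    have V: "x \<in> V" "q \<in> V" using q(1) in_arcsD1 in_arcsD2 by simp_all
    note tri = dist_triangle[OF v V(2) wV[OF i]] dist_triangle[OF V(2) V(1) wV[OF i]]
      dist_triangle[OF v V]
    have e: "d x q = 1" "d q x = 1" using dist_edge[OF q(1)] dist_commute[OF V] by simp_all
    have "d v q + d q (w i) = d v (w i)"
      using q(2)
    proof
      assume "v \<in> branch x q"
      then have "d v x = Suc (d v q)"
        using branch_dist dist_commute[OF v V(1)] dist_commute[OF v V(2)] by metis
      then show ?thesis using tri e x by (simp add: P_def)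
    next
      assume "w i \<in> branch x q"
      then have "d x (w i) = Suc (d q (w i))" by (rule branch_dist)
      then show ?thesis using tri e x by (simp add: P_def)
    qed
    then show ?thesis using V(2) by (simp add: P_def)
  qed
  \<comment> \<open>If \<open>y\<close> is farther from \<open>v\<close> than \<open>x\<close>, then
    \<open>x\<close> lies on the path containing \<open>y\<close>. Away from \<open>v\<close> that
    path is unique, so \<open>y\<close> is nearer to \<open>w i\<close>. With \<open>P_step\<close>
    this determines all degrees in \<open>H\<close>.\<close>
  have P_neighbour: "v \<in> branch x y \<or> w i \<in> branch x y"
    if x: "x \<in> P i" "x \<noteq> v" and y: "y \<in> W" "(x, y) \<in> E" and i: "i < 3" for x y i
  proof (cases "v \<in> branch x y")
    case False
    then have vy: "v \<in> branch y x" using branch_cases[OF y(2) v] by simp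
    obtain j where j: "y \<in> P j" "j < 3" using y(1) by (auto simp: W_def)
    have "x \<in> P j" using P_step[OF j(1) edge_sym[OF y(2)] _ j(2)] vy by simp
    then have "j = i" using P_unique x i j by metis
    moreover have "d v y = Suc (d v x)"
      using branch_dist[OF vy] dist_commute[OF v] P_V[OF x(1)] P_V[OF j(1)] by simp
    ultimately have "d x (w i) = Suc (d y (w i))"
      using x(1) j(1) by (simp add: P_def)
    then show ?thesis using wV[OF i] by (simp add: branch_def)
  qed simp
  have parent: "\<exists>p. (x, p) \<in> E \<and> v \<in> branch x p" if "x \<in> V" "x \<noteq> v" for x
    using ex_branch[OF that(1) v] that(2) by metis
  have sub: "subgraph (with_proj H) (with_proj T)"
    unfolding subgraph_def using W_V
    by (auto simp: H_simps wf_digraph intro!: wf_digraph.intro)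
  have ind: "induced_subgraph (with_proj H) (with_proj T)"
    unfolding induced_subgraph_def using sub by (auto simp: H_simps)
  have graph_H: "pair_graph H"
  proof
    show "finite (pverts H)" using finite_subset[OF W_V pair_finite_verts] by (simp add: H_simps(1))
    show "finite (parcs H)"
      using pair_finite_arcs by (rule finite_subset[rotated]) (auto simp: H_simps)
    show "symmetric (with_proj H)"
      by (auto simp: symmetric_def sym_def H_simps edge_sym)
  qed (auto simp: H_simps dest: no_loops')
  interpret H: pair_graph H by (rule graph_H)
  have from_v: "v \<rightarrow>\<^sup>*\<^bsub>with_proj H\<^esub> x" if "x \<in> W" for x
    using that
  proof (induction "d v x" arbitrary: x rule: less_induct)
    case less
    show ?case
    proof (cases "x = v")
      case True
      then show ?thesis using v_W by (simp add: H_simps)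
    next
      case False
      obtain i where i: "x \<in> P i" "i < 3" using less.prems by (auto simp: W_def)
      obtain p where p: "(x, p) \<in> E" "v \<in> branch x p" using parent[OF P_V[OF i(1)] False] by metis
      have pP: "p \<in> P i" using P_step[OF i(1) p(1) _ i(2)] p(2) by simp
      then have pW: "p \<in> W" using P_W i(2) by simp
      have "d v p < d v x"
        using branch_dist[OF p(2)] dist_commute[OF v] P_V[OF i(1)] P_V[OF pP] by simp
      then have "v \<rightarrow>\<^sup>*\<^bsub>with_proj H\<^esub> p" using less.hyps pW by simp
      moreover have "(p, x) \<in> parcs H" using edge_sym[OF p(1)] pW less.prems by (simp add: H_simps)
      ultimately show ?thesis by (rule H.reachable_adj_trans)
    qed
  qed
  have tree_H: "undir_tree H"
  proof (intro undir_tree.intro undir_tree_axioms.intro graph_H)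
    show "connected (with_proj H)"
    proof (rule H.connectedI)
      show "pverts H \<noteq> {}" using v_W by (auto simp: H_simps)
      fix x y assume xy: "x \<in> pverts H" "y \<in> pverts H"
      have "x \<rightarrow>\<^sup>*\<^bsub>with_proj H\<^esub> v"
        using H.symmetric_reachable'[OF from_v[of x]] xy(1) by (simp add: H_simps)
      moreover have "v \<rightarrow>\<^sup>*\<^bsub>with_proj H\<^esub> y" using from_v xy(2) by (simp add: H_simps)
      ultimately have "x \<rightarrow>\<^sup>*\<^bsub>with_proj H\<^esub> y" by (rule H.reachable_trans)
      then show "x \<rightarrow>\<^sup>*\<^bsub>with_proj (mk_symmetric (with_proj H))\<^esub> y"
        using H.reachable_mk_symmetric_eq[OF H.pair_sym_arcs] by simp
    qed
    show "\<not> (pre_digraph.cycle (with_proj H) c \<and> 3 \<le> length c)" for c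
      using subgraph_cycle[OF sub, of c] no_long_cycle[of c] by metis
  qed
  interpret H: undir_tree H by (rule tree_H)
  have deg_v: "card {y. (v, y) \<in> parcs H} = 3"
  proof -
    have "{y. (v, y) \<in> parcs H} = u ` {..<3}"
    proof
      show "{y. (v, y) \<in> parcs H} \<subseteq> u ` {..<3}"
      proof
        fix y assume "y \<in> {y. (v, y) \<in> parcs H}"
        then have y: "(v, y) \<in> E" "y \<in> W" by (simp_all add: H_simps)
        then obtain j where j: "y \<in> P j" "j < 3" by (auto simp: W_def)
        have "y \<noteq> v" using no_loops'[OF y(1)] by metis
        then have "y = u j"
          using branch_disjoint[OF y(1) vu[OF j(2)] neighbour_in_branch[OF y(1)]] P_branch j by metis
        then show "y \<in> u ` {..<3}" using j(2) by simp
      qed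
      show "u ` {..<3} \<subseteq> {y. (v, y) \<in> parcs H}"
        using P_W[OF P_step[OF v_P vu]] w vu v_W by (auto simp: H_simps)
    qed
    then show ?thesis using inj by (simp add: card_image)
  qed
  have deg_w: "card {y. (w i, y) \<in> parcs H} = 1" if i: "i < 3" for i
  proof -
    have ne: "w i \<noteq> v" using w[OF i] not_in_own_branch by metis
    obtain p where p: "(w i, p) \<in> E" "v \<in> branch (w i) p" using parent[OF wV[OF i] ne] by metis
    have "{y. (w i, y) \<in> parcs H} = {p}"
    proof
      show "{y. (w i, y) \<in> parcs H} \<subseteq> {p}"
        using P_neighbour[OF w_P[OF i] ne _ _ i] not_in_own_branch branch_disjoint[OF p(1) _ p(2)]
        by (auto simp: H_simps)
      have "p \<in> W" using P_W[OF P_step[OF w_P[OF i] p(1) _ i] i] p(2) by simp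
      then show "{p} \<subseteq> {y. (w i, y) \<in> parcs H}"
        using p(1) P_W[OF w_P[OF i] i] by (simp add: H_simps)
    qed
    then show ?thesis by simp
  qed
  have deg_inner: "card {y. (x, y) \<in> parcs H} = 2"
    if x: "x \<in> P i" "x \<noteq> v" "x \<noteq> w i" and i: "i < 3" for x i
  proof -
    have xV: "x \<in> V" using P_V[OF x(1)] .
    obtain p where p: "(x, p) \<in> E" "v \<in> branch x p" using parent[OF xV x(2)] by metis
    obtain q where q: "(x, q) \<in> E" "w i \<in> branch x q" using ex_branch[OF xV wV[OF i]] x(3) by metis
    \<comment> \<open>A common neighbour nearer to both \<open>v\<close> and \<open>w i\<close>
      would give a walk between them shorter than their distance.\<close>
    have "p \<noteq> q"
    proof
      assume "p = q"
      then have "d p (w i) < d x (w i)" "d v p < d v x"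
        using branch_dist[OF p(2)] branch_dist[OF q(2)] dist_commute[OF v] xV in_arcsD2[OF p(1)]
        by simp_all
      then show False
        using dist_triangle[OF v in_arcsD2[OF p(1)] wV[OF i]] x(1) by (simp add: P_def)
    qed
    have pq: "p \<in> W" "q \<in> W"
      using P_W[OF P_step[OF x(1) _ _ i] i] p q by metis+
    have "{y. (x, y) \<in> parcs H} = {p, q}"
    proof
      show "{y. (x, y) \<in> parcs H} \<subseteq> {p, q}"
      proof
        fix y assume "y \<in> {y. (x, y) \<in> parcs H}"
        then have y: "(x, y) \<in> E" "y \<in> W" by (simp_all add: H_simps)
        then have "v \<in> branch x y \<or> w i \<in> branch x y" using P_neighbour x(1,2) i by metis
        then show "y \<in> {p, q}"
          using branch_disjoint[OF y(1) p(1) _ p(2)] branch_disjoint[OF y(1) q(1) _ q(2)] by auto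
      qed
      show "{p, q} \<subseteq> {y. (x, y) \<in> parcs H}"
        using pq p(1) q(1) P_W[OF x(1) i] by (simp add: H_simps)
    qed
    then show ?thesis using \<open>p \<noteq> q\<close> by simp
  qed
  have leaves_H: "leaves H = w ` {..<3}"
  proof
    show "leaves H \<subseteq> w ` {..<3}"
    proof
      fix x assume "x \<in> leaves H"
      then have x: "x \<in> W" "card {y. (x, y) \<in> parcs H} = 1" by (simp_all add: H.leaves_iff H_simps(1))
      obtain i where i: "x \<in> P i" "i < 3" using x(1) by (auto simp: W_def)
      have "x \<noteq> v" using x(2) deg_v by auto
      then have "x = w i" using deg_inner[OF i(1) _ _ i(2)] x(2) by fastforce
      then show "x \<in> w ` {..<3}" using i(2) by simp
    qed
    show "w ` {..<3} \<subseteq> leaves H"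
      using deg_w P_W[OF w_P] by (auto simp: H.leaves_iff H_simps(1))
  qed
  have "inj_on w {..<3}"
  proof (rule inj_onI)
    fix i j assume ij: "i \<in> {..<3}" "j \<in> {..<3}" "w i = w j"
    then have "i < 3" "j < 3" by simp_all
    moreover have "w i \<noteq> v" using w[OF \<open>i < 3\<close>] not_in_own_branch by metis
    ultimately show "i = j" using P_unique[of "w i" i j] w_P[of i] w_P[of j] ij(3) by simp
  qed
  then have "card (leaves H) = 3" by (simp add: leaves_H card_image)
  moreover have only_v: "x = v" if x: "x \<in> W" "card {y. (x, y) \<in> parcs H} = 3" for x
  proof (rule ccontr)
    assume "x \<noteq> v"
    obtain i where i: "x \<in> P i" "i < 3" using x(1) by (auto simp: W_def)
    show False using deg_inner[OF i(1) \<open>x \<noteq> v\<close> _ i(2)] deg_w[OF i(2)] x(2) by (cases "x = w i") auto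
  qed
  ultimately have "triod H v"
    unfolding triod_def undirected_tree_iff H.out_degree_eq H_simps(1)
    by (intro conjI ballI impI tree_H deg_v v_W only_v)
  moreover have "L \<le> triod_ell3 H v"
  proof -
    have "graph_dist H v (w i) = d v (w i)" if "i < 3" for i
      by (rule dist_subtree[OF tree_H]) (use W_V v_W P_W[OF w_P] that in \<open>auto simp: H_simps\<close>)
    then have "\<forall>l \<in> graph_dist H v ` leaves H. L \<le> l" using L by (auto simp: leaves_H)
    then show ?thesis
      unfolding triod_ell3_def using H.finite_leaves by (intro Min.boundedI) (auto simp: leaves_H lessThan_empty_iff)
  qed
  ultimately show thesis using that ind by metis
qed

text \<open>A subgraph is given by a subset of \<open>V\<close> and a subset of \<open>E\<close>.
  Finiteness gives \<open>Max\<close> in \<open>ell3\<close> its meaning.\<close>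

lemma finite_triod_ell3:
  "finite {triod_ell3 H v | H. induced_subgraph (with_proj H) (with_proj T) \<and> triod H v}"
proof -
  let ?S = "(\<lambda>(A, B). \<lparr>pverts = A, parcs = B\<rparr>) ` (Pow V \<times> Pow E)"
  have H: "H \<in> ?S" if "induced_subgraph (with_proj H) (with_proj T)" for H :: "'a pair_pre_digraph"
  proof (rule image_eqI)
    show "H = (case (pverts H, parcs H) of (A, B) \<Rightarrow> \<lparr>pverts = A, parcs = B\<rparr>)" by simp
    show "(pverts H, parcs H) \<in> Pow V \<times> Pow E"
      using that by (simp add: induced_subgraph_def subgraph_def)
  qed
  have "finite ((\<lambda>H. triod_ell3 H v) ` ?S)" using pair_finite_verts pair_finite_arcs by simp
  then show ?thesis
    by (rule finite_subset[rotated]) (use H in blast)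
qed

section \<open>Comparison with \<open>ell3\<close>, and the value of the patrol radius\<close>

lemma three_branches_mono: "three_branches L v \<Longrightarrow> L' \<le> L \<Longrightarrow> three_branches L' v"
  unfolding three_branches_def by (meson order_trans)

lemma le_out_degree:
  assumes "three_branches L v"
  shows "3 \<le> out_degree (with_proj T) v"
proof -
  obtain u :: "nat \<Rightarrow> 'a" where u: "inj_on u {..<3}" "\<And>i. i < 3 \<Longrightarrow> (v, u i) \<in> E"
    using assms unfolding three_branches_def by metis
  have "finite {y. (v, y) \<in> E}"
    by (rule finite_subset[OF _ pair_finite_verts]) (use in_arcsD2 in blast)
  then have "card (u ` {..<3}) \<le> card {y. (v, y) \<in> E}"
    by (rule card_mono) (use u(2) in blast)
  then show ?thesis using card_image[OF u(1)] by (simp add: out_degree_eq)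
qed

lemma le_ell3:
  assumes "three_branches L v"
  shows "L \<le> ell3 T v"
proof -
  obtain H where H: "induced_subgraph (with_proj H) (with_proj T)" "triod H v" "L \<le> triod_ell3 H v"
    using three_branches_imp_triod[OF assms] by metis
  note H(3)
  also have "triod_ell3 H v \<le> ell3 T v"
    using finite_triod_ell3[of v] le_out_degree[OF assms] H(1,2)
    unfolding ell3_def by (auto intro!: Max_ge)
  finally show ?thesis .
qed

text \<open>Positivity excludes the default value 0 for small degrees, so the maximum is attained by
  some triod once one exists.\<close>

lemma three_branches_ell3:
  assumes pos: "0 < ell3 T v"
  shows "three_branches (ell3 T v) v"
proof -
  let ?S = "{triod_ell3 H v | H. induced_subgraph (with_proj H) (with_proj T) \<and> triod H v}"
  have deg: "3 \<le> out_degree (with_proj T) v"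
    using pos unfolding ell3_def by (auto split: if_splits)
  then have "3 \<le> card {y. (v, y) \<in> E}" by (simp add: out_degree_eq)
  then obtain B where "B \<subseteq> {y. (v, y) \<in> E}" "card B = 3"
    by (rule obtain_subset_with_card_n)
  then obtain y1 y2 y3 where y: "(v, y1) \<in> E" "(v, y2) \<in> E" "(v, y3) \<in> E"
    "y1 \<noteq> y2" "y1 \<noteq> y3" "y2 \<noteq> y3"
    by (auto simp: card_3_iff)
  \<comment> \<open>Length 0 makes any three neighbours suffice, which yields a first triod.\<close>
  have "three_branches 0 v"
    using three_branchesI[OF y(1) neighbour_in_branch[OF y(1)] _ y(2) neighbour_in_branch[OF y(2)] _
        y(3) neighbour_in_branch[OF y(3)] _ y(4-6)] by simp
  then obtain H where "induced_subgraph (with_proj H) (with_proj T)" "triod H v"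
    using three_branches_imp_triod by metis
  then have "?S \<noteq> {}" by blast
  then have "Max ?S \<in> ?S" by (rule Max_in[OF finite_triod_ell3])
  then have "ell3 T v \<in> ?S" using deg by (simp add: ell3_def)
  then obtain H where "ell3 T v = triod_ell3 H v"
    "induced_subgraph (with_proj H) (with_proj T)" "triod H v"
    by blast
  then show ?thesis using triod_imp_three_branches by metis
qed

text \<open>The legs are cut to the exact length \<open>2 * k + 2\<close> that
  \<open>robber_escapes\<close> expects, by taking \<open>a i\<close> on the path from
  \<open>v\<close> to \<open>w i\<close>.\<close>

lemma robber_wins:
  assumes "three_branches (2 * k + 2) v"
  shows "\<not> winning_patrol T k c"
proof
  assume win: "winning_patrol T k c"
  define L where "L = 2 * k + 2"
  obtain u w :: "nat \<Rightarrow> 'a" where inj: "inj_on u {..<3}" and vu: "\<And>i. i < 3 \<Longrightarrow> (v, u i) \<in> E"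
    and w: "\<And>i. i < 3 \<Longrightarrow> w i \<in> branch v (u i)" and L: "\<And>i. i < 3 \<Longrightarrow> L \<le> d v (w i)"
    using assms unfolding three_branches_def L_def by metis
  have v: "v \<in> V" using in_arcsD1[OF vu[of 0]] by simp
  have wV: "w i \<in> V" if "i < 3" for i using branch_V[OF w[OF that]] .
  have "\<exists>a. a \<in> V \<and> d v a = L \<and> d a (w i) = d v (w i) - L" if i: "i < 3" for i
    using geodesic[OF v wV[OF i]] L[OF i] by metis
  then obtain a where a: "\<And>i. i < 3 \<Longrightarrow> a i \<in> V" "\<And>i. i < 3 \<Longrightarrow> d v (a i) = L"
    "\<And>i. i < 3 \<Longrightarrow> d (a i) (w i) = d v (w i) - L"
    by metis
  have "d (a i) (a j) = 4 * k + 4" if ij: "i < 3" "j < 3" "i \<noteq> j" for i j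
  proof (rule antisym)
    show "d (a i) (a j) \<le> 4 * k + 4"
      using dist_triangle[OF a(1)[OF ij(1)] v a(1)[OF ij(2)]] a(2)[OF ij(1)] a(2)[OF ij(2)]
        dist_commute[OF v a(1)[OF ij(1)]] by (simp add: L_def)
    have "u i \<noteq> u j" using inj_onD[OF inj, of i j] ij by auto
    \<comment> \<open>The far vertices lie in different branches, so their distance is the full sum;
      removing the tails beyond \<open>a i\<close> and \<open>a j\<close> leaves twice the leg
      length.\<close>
    then have "d (w i) (w j) = d v (w i) + d v (w j)"
      by (rule dist_branches[OF vu[OF ij(1)] vu[OF ij(2)] _ w[OF ij(1)] w[OF ij(2)]])
    moreover have "d (w i) (w j) \<le> d (w i) (a i) + d (a i) (w j)"
      by (rule dist_triangle[OF wV[OF ij(1)] a(1)[OF ij(1)] wV[OF ij(2)]])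
    moreover have "d (a i) (w j) \<le> d (a i) (a j) + d (a j) (w j)"
      by (rule dist_triangle[OF a(1)[OF ij(1)] a(1)[OF ij(2)] wV[OF ij(2)]])
    moreover have "d (w i) (a i) = d v (w i) - L"
      using a(3)[OF ij(1)] dist_commute[OF a(1)[OF ij(1)] wV[OF ij(1)]] by simp
    ultimately show "4 * k + 4 \<le> d (a i) (a j)"
      using a(3)[OF ij(2)] L[OF ij(1)] L[OF ij(2)] unfolding L_def by linarith
  qed
  moreover have "lazy_walk T c" using win by (simp add: winning_patrol_def)
  ultimately obtain r where "lazy_walk T r" "\<not> captured T k c r"
    using robber_escapes[OF v, of a k c] a(1,2) unfolding L_def by metis
  then show False using win by (simp add: winning_patrol_def)
qed

lemma patrol_radius_eq: "patrol_radius T = (MAX v\<in>V. ell3 T v div 2)"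
proof -
  define M where "M = (MAX v\<in>V. ell3 T v div 2)"
  have fin: "finite ((\<lambda>v. ell3 T v div 2) ` V)" using pair_finite_verts by simp
  have "M \<in> (\<lambda>v. ell3 T v div 2) ` V"
    unfolding M_def by (rule Max_in[OF fin]) (use V_nonempty in blast)
  then obtain v where v: "v \<in> V" "M = ell3 T v div 2" by blast
  have "\<exists>c. winning_patrol T M c"
  proof (rule cop_wins)
    fix x assume x: "x \<in> V"
    show "\<not> three_branches (2 * M + 2) x"
    proof
      assume "three_branches (2 * M + 2) x"
      then have "2 * M + 2 \<le> ell3 T x" by (rule le_ell3)
      then have "M < ell3 T x div 2" by linarith
      also have "\<dots> \<le> M" unfolding M_def using fin x by (intro Max_ge) simp_all
      finally show False by simp
    qed
  qed
  moreover have "M \<le> k" if win: "\<exists>c. winning_patrol T k c" for k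
  proof (rule ccontr)
    assume "\<not> M \<le> k"
    \<comment> \<open>This is where the rounding comes from: \<open>2 * k + 2\<close> \<le>
      \<open>ell3 T v\<close> holds exactly when \<open>k < ell3 T v div 2\<close>.\<close>
    then have k: "2 * k + 2 \<le> ell3 T v" using v(2) by linarith
    then have "three_branches (2 * k + 2) v"
      using three_branches_mono[OF three_branches_ell3] by simp
    then show False using robber_wins win by metis
  qed
  ultimately show ?thesis
    unfolding patrol_radius_def M_def[symmetric] by (rule Least_equality)
qed

end

theorem theorem4:
  fixes T :: "'a pair_pre_digraph"
  assumes "undirected_tree T"
  shows "patrol_radius T = (MAX v\<in>pverts T. ell3 T v div 2)"
proof -
  interpret undir_tree T using assms by (simp add: undirected_tree_iff)
  show ?thesis by (rule patrol_radius_eq)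
qed

end
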